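(* Let $\widetilde{G}$ be a mixed graph with underlying graph $G$. Then $rk(\widetilde{G})-r(G)=-2d(G)$ if and only if all of the following hold: (i) the mixed cycles (if any) of $\widetilde{G}$ are pairwise vertex-disjoint; (ii) for each mixed cycle $\widetilde{C}_l$ of $\widetilde{G}$ (of length $l$), $l\equiv 2\pmod 4$ and $\eta(\widetilde{C}_l)\equiv 2\pmod 4$; (iii) a series of $\delta$-transformations can switch $G$ to a crucial subgraph which is the disjoint union of $d(G)$ induced cycles together with some isolated vertices.
   Context: All graphs are finite and simple. A mixed graph $\widetilde{G}$ is obtained from a simple graph $G$ (its underlying graph) by orienting some of its edges. The Hermitian adjacency matrix $H(\widetilde{G})=(h_{uv})$ has $h_{uv}=1$ for an undirected edge $\{u,v\}$, $h_{uv}=i$ for an arc $(u,v)$, $h_{uv}=-i$ for an arc $(v,u)$, $0$ otherwise; $rk(\widetilde{G})$ is its rank and $r(G)$ is the rank of the adjacency matrix of $G$. $d(G)=|E_G|-|V_G|+\omega(G)$ with $\omega(G)$ the number of components. A mixed cycle of $\widetilde{G}$ is a cycle of $G$ with the orientations/non-orientations its edges have in $\widetilde{G}$. The signature $\eta(\widetilde{C})$ of a mixed cycle is $|f-b|$, where, traversing the cycle in one direction, $f$ is the number of arcs oriented forward and $b$ the number oriented backward (undirected edges are not counted). A pendant vertex is a vertex of degree one. A $\delta$-transformation on a graph with a pendant vertex deletes a pendant vertex together with its neighbour. For a graph whose cycles are pairwise vertex-disjoint, one repeatedly applies $\delta$-transformations until an induced subgraph without pendant vertices is obtained; this resulting induced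 subgraph is called a crucial subgraph. *)

theory Defs
  imports "HOL-Analysis.Analysis"
begin

type_synonym 'v graph = "'v set \<times> 'v set set"

definition simple_graph :: "'v graph \<Rightarrow> bool" where
  "simple_graph G \<longleftrightarrow> finite (fst G) \<and> (\<forall>e\<in>snd G. e \<subseteq> fst G \<and> card e = 2)"

text \<open>The mixed graph obtained from \<open>G\<close> by orienting some edges is given by \<open>G\<close> together with the
  set of arcs; \<open>(u, v)\<close> is the edge \<open>{u, v}\<close> oriented from \<open>u\<close> to \<open>v\<close>.\<close>

definition mixed_graph :: "'v graph \<Rightarrow> ('v \<times> 'v) set \<Rightarrow> bool" where
  "mixed_graph G A \<longleftrightarrow> simple_graph G \<and> (\<forall>u v. (u, v) \<in> A \<longrightarrow> {u, v} \<in> snd G \<and> (v, u) \<notin> A)"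

text \<open>The matrices are indexed by the whole (finite) vertex type, so they are the matrices of graphs
  whose vertex set is \<open>UNIV\<close>.\<close>

definition adjacency_matrix :: "'v::finite graph \<Rightarrow> real^'v^'v" where
  "adjacency_matrix G = (\<chi> u v. if {u, v} \<in> snd G then 1 else 0)"

definition hermitian_adjacency_matrix :: "'v::finite graph \<Rightarrow> ('v \<times> 'v) set \<Rightarrow> complex^'v^'v" where
  "hermitian_adjacency_matrix G A =
     (\<chi> u v. if (u, v) \<in> A then \<i>
             else if (v, u) \<in> A then - \<i>
             else if {u, v} \<in> snd G then 1
             else 0)"

definition connected_rel :: "'v graph \<Rightarrow> ('v \<times> 'v) set" where
  "connected_rel G = {(u, v). u \<in> fst G \<and> v \<in> fst G \<and> (u, v) \<in> {(x, y). {x, y} \<in> snd G}\<^sup>*}"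

definition num_components :: "'v graph \<Rightarrow> nat" where
  "num_components G = card (fst G // connected_rel G)"

definition cyclomatic_number :: "'v graph \<Rightarrow> int" where
  "cyclomatic_number G = int (card (snd G)) - int (card (fst G)) + int (num_components G)"

text \<open>A list of distinct vertices represents a cycle together with a starting point and a direction
  of traversal; the cycle itself is the subgraph formed by its vertices and edges.\<close>

definition next_vertex :: "'v list \<Rightarrow> nat \<Rightarrow> 'v" where
  "next_vertex c i = c ! (Suc i mod length c)"

definition cycle_edges :: "'v list \<Rightarrow> 'v set set" where
  "cycle_edges c = {{c ! i, next_vertex c i} | i. i < length c}"

definition is_cycle :: "'v graph \<Rightarrow> 'v list \<Rightarrow> bool" where
  "is_cycle G c \<longleftrightarrow> 3 \<le> length c \<and> distinct c \<and> set c \<subseteq> fst G \<and> cycle_edges c \<subseteq> snd G"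

definition cycles :: "'v graph \<Rightarrow> 'v graph set" where
  "cycles G = {(set c, cycle_edges c) | c. is_cycle G c}"

definition vertex_disjoint :: "'v graph set \<Rightarrow> bool" where
  "vertex_disjoint \<C> \<longleftrightarrow> (\<forall>C\<in>\<C>. \<forall>D\<in>\<C>. C \<noteq> D \<longrightarrow> fst C \<inter> fst D = {})"

definition forward_arcs :: "('v \<times> 'v) set \<Rightarrow> 'v list \<Rightarrow> nat" where
  "forward_arcs A c = card {i. i < length c \<and> (c ! i, next_vertex c i) \<in> A}"

definition backward_arcs :: "('v \<times> 'v) set \<Rightarrow> 'v list \<Rightarrow> nat" where
  "backward_arcs A c = card {i. i < length c \<and> (next_vertex c i, c ! i) \<in> A}"

definition signature :: "('v \<times> 'v) set \<Rightarrow> 'v list \<Rightarrow> int" where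
  "signature A c = \<bar>int (forward_arcs A c) - int (backward_arcs A c)\<bar>"

definition induced_subgraph :: "'v graph \<Rightarrow> 'v set \<Rightarrow> 'v graph" where
  "induced_subgraph G W = (W, {e \<in> snd G. e \<subseteq> W})"

definition degree :: "'v graph \<Rightarrow> 'v \<Rightarrow> nat" where
  "degree G u = card {e \<in> snd G. u \<in> e}"

definition pendant :: "'v graph \<Rightarrow> 'v \<Rightarrow> bool" where
  "pendant G u \<longleftrightarrow> u \<in> fst G \<and> degree G u = 1"

inductive delta_transformation :: "'v graph \<Rightarrow> 'v graph \<Rightarrow> bool" where
  "pendant G u \<Longrightarrow> {u, v} \<in> snd G \<Longrightarrow>
     delta_transformation G (induced_subgraph G (fst G - {u, v}))"

definition crucial_subgraph :: "'v graph \<Rightarrow> 'v graph \<Rightarrow> bool" where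
  "crucial_subgraph G H \<longleftrightarrow> delta_transformation\<^sup>*\<^sup>* G H \<and> (\<forall>u. \<not> pendant H u)"

text \<open>The set \<open>I\<close> of isolated vertices may be empty.\<close>

definition union_of_cycles_and_isolated :: "int \<Rightarrow> 'v graph \<Rightarrow> bool" where
  "union_of_cycles_and_isolated k H \<longleftrightarrow>
     (\<exists>\<C> I. finite \<C> \<and> int (card \<C>) = k \<and>
        \<C> \<subseteq> cycles H \<and> (\<forall>C\<in>\<C>. C = induced_subgraph H (fst C)) \<and> vertex_disjoint \<C> \<and>
        I \<inter> (\<Union>C\<in>\<C>. fst C) = {} \<and>
        H = ((\<Union>C\<in>\<C>. fst C) \<union> I, \<Union>C\<in>\<C>. snd C))"

end

theory Submission
  imports Defs
begin

text \<open>Ranks are replaced by nullities of principal submatrices. Deleting a vertex changes a nullity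
  by at most one, and a \<open>\<delta>\<close>-transformation does not change it. Deleting vertices of cycles until the
  graph is a forest, where both matrices have the same nullity, shows that the nullity of the Hermitian
  matrix exceeds that of the adjacency matrix by at most \<open>2 d(G)\<close>. In the case of equality, every
  deletion of a vertex on a cycle must lower the cyclomatic number by exactly one, which forces the
  cycles to be disjoint, and must lower the Hermitian nullity by exactly one. Equality is inherited by
  the deletion of a vertex on a cycle and by \<open>\<delta>\<close>-transformations.

  On a cycle, the kernel equation is a recurrence with step two, so that its kernel is governed by the
  product of the weights along the cycle. If a cycle of a pendant-free graph with equality had an edge
  leaving it at \<open>y\<close>, a vector could be constructed outward along this edge, deleting at most one
  vertex from each other cycle, which violates the kernel equations only at \<open>y\<close>; the deletion of \<open>y\<close>
  would then not lower the nullity.\<close>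

section \<open>Rank and nullity over a field\<close>

text \<open>Condition (ii) comes from comparing two products. In a graph with equality, a cycle of
  length \<open>l\<close> turns out to have Hermitian nullity 2 and adjacency nullity 0. Nullity 2
  forces \<open>l\<close> to be even and the product of the weights to be
  \<open>(-1) ^ (l div 2)\<close>; nullity 0 forbids this value. The product is 1 for the adjacency
  matrix and \<open>\<i>\<close> to the power (forward minus backward arcs) for the Hermitian one,
  so \<open>l div 2\<close> is odd and the second product is -1. The obstacle is a circularity.
  Extending the outward vector over another cycle takes a kernel vector of that cycle without zeros,
  which exists by condition (ii) for it; but (ii) is deduced from the absence of edges leaving a
  cycle. Hence one cycle is isolated first: a vertex of every other cycle is deleted, and in the
  pendant-free rest the vector only has to pass through single vertices. With (ii) known for all
  cycles, the argument is repeated in the presence of all of them and yields (iii).\<close>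

lemma dim_functional_kernel:
  fixes S :: "('a::field^'n) set" and \<phi> :: "'a^'n \<Rightarrow> 'a"
  assumes S: "vec.subspace S"
    and add: "\<And>x y. \<phi> (x + y) = \<phi> x + \<phi> y" and scale: "\<And>c x. \<phi> (c *s x) = c * \<phi> x"
    and x0: "x0 \<in> S" "\<phi> x0 \<noteq> 0"
  shows "vec.dim S = vec.dim (S \<inter> {x. \<phi> x = 0}) + 1"
proof -
  let ?T = "S \<inter> {x. \<phi> x = 0}"
  have z: "\<phi> 0 = 0" using scale[of 0 0] by simp
  have T: "vec.subspace ?T"
    using S z by (auto simp: vec.subspace_def add scale)
  have "S = vec.span (insert x0 ?T)"
  proof
    show "S \<subseteq> vec.span (insert x0 ?T)"
    proof
      fix x assume x: "x \<in> S"
      define c where "c = \<phi> x / \<phi> x0"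
      have "x - c *s x0 \<in> S"
        using S x x0 by (simp add: vec.subspace_diff vec.subspace_scale)
      moreover have "\<phi> (x - c *s x0) = 0"
        using add[of x "(-c) *s x0"] scale[of "-c" x0] x0 by (simp add: c_def)
      ultimately have "x - c *s x0 \<in> vec.span (insert x0 ?T)"
        by (intro vec.span_base) auto
      moreover have "c *s x0 \<in> vec.span (insert x0 ?T)"
        by (intro vec.span_scale vec.span_base) auto
      ultimately have "(x - c *s x0) + c *s x0 \<in> vec.span (insert x0 ?T)"
        by (rule vec.span_add)
      then show "x \<in> vec.span (insert x0 ?T)" by simp
    qed
    show "vec.span (insert x0 ?T) \<subseteq> S"
      using S x0 by (intro vec.span_minimal) auto
  qed
  then have "vec.dim S = vec.dim (insert x0 ?T)"
    by (metis vec.dim_span)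
  moreover have "x0 \<notin> vec.span ?T"
  proof -
    have "vec.span ?T \<subseteq> ?T" using T by (intro vec.span_minimal) auto
    then show ?thesis using x0 by auto
  qed
  ultimately show ?thesis
    by (simp add: vec.dim_insert)
qed

lemma dim_functional_kernel_le:
  fixes S :: "('a::field^'n) set" and \<phi> :: "'a^'n \<Rightarrow> 'a"
  assumes S: "vec.subspace S"
    and add: "\<And>x y. \<phi> (x + y) = \<phi> x + \<phi> y" and scale: "\<And>c x. \<phi> (c *s x) = c * \<phi> x"
  shows "vec.dim S \<le> vec.dim (S \<inter> {x. \<phi> x = 0}) + 1"
proof (cases "\<exists>x0\<in>S. \<phi> x0 \<noteq> 0")
  case True
  then show ?thesis using dim_functional_kernel[OF S add scale] by auto
next
  case False
  then have "S \<inter> {x. \<phi> x = 0} = S" by auto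
  then show ?thesis by simp
qed

lemma mult_vec_add: "(M *v (x + y)) $ v = (M *v x) $ v + (M *v y) $ v"
  for M :: "'a::field^'n^'m"
  by (simp add: matrix_vector_right_distrib)

lemma mult_vec_scale: "(M *v (c *s x)) $ v = c * (M *v x) $ v"
  for M :: "'a::field^'n^'m"
  by (simp add: matrix_vector_mult_def sum_distrib_left algebra_simps)

lemma mult_vec_axis: "(M *v axis u 1) $ v = M $ v $ u" for M :: "'a::field^'n^'m"
proof -
  have "(M *v axis u 1) $ v = (\<Sum>w\<in>UNIV. if w = u then M $ v $ w else 0)"
    by (simp add: matrix_vector_mult_def axis_def if_distrib cong: if_cong)
  then show ?thesis by simp
qed

text \<open>A basis of the kernel is extended to a basis of the whole space; on the span of the
  added vectors \<open>A\<close> is injective and already reaches its whole range.\<close>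

lemma vec_rank_nullity:
  fixes A :: "'a::field^'n^'m"
  shows "vec.dim (range ((*v) A)) + vec.dim {x. A *v x = 0} = CARD('n)"
proof -
  let ?N = "{x. A *v x = 0}"
  have N: "vec.subspace ?N"
    by (auto simp: vec.subspace_def matrix_vector_right_distrib matrix_vector_mult_scaleR vec.scale)
  obtain B where B: "B \<subseteq> ?N" "vec.independent B" "?N \<subseteq> vec.span B" "card B = vec.dim ?N"
    using vec.basis_exists by blast
  obtain D where D: "B \<subseteq> D" "vec.independent D" "vec.span D = UNIV"
    using vec.maximal_independent_subset_extend[OF subset_UNIV B(2)] top.extremum_uniqueI by metis
  have finD: "finite D" using D(2) vec.finiteI_independent by auto
  have spB: "vec.span B = ?N"
    using B(1,3) N vec.span_minimal by blast
  let ?S = "vec.span (D - B)"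
  have dimS: "vec.dim ?S + vec.dim ?N = CARD('n)"
  proof -
    have "vec.dim ?S = card (D - B)"
      using vec.independent_mono[OF D(2), of "D - B"] by (intro vec.dim_span_eq_card_independent) auto
    moreover have "card D = CARD('n)"
      using D vec.dim_span_eq_card_independent[OF D(2)] by (simp add: card_cart_basis)
    moreover have "card D = card (D - B) + card B"
      using D(1) finD by (metis card_Diff_subset card_mono finite_subset le_add_diff_inverse2)
    ultimately show ?thesis using B(4) by simp
  qed
  \<comment> \<open>The two spans add up to the whole space and so do their dimensions, which leaves
    dimension 0 for the intersection.\<close>
  have int0: "?S \<inter> vec.span B \<subseteq> {0}"
  proof -
    have "vec.dim {x + y |x y. x \<in> ?S \<and> y \<in> vec.span B} + vec.dim (?S \<inter> vec.span B) = vec.dim ?S + vec.dim (vec.span B)"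
      by (intro vec.dim_sums_Int) auto
    moreover have "{x + y |x y. x \<in> ?S \<and> y \<in> vec.span B} = UNIV"
      using D(1,3) vec.span_Un[of "D - B" B] by (simp add: Un_absorb2)
    ultimately have "vec.dim (?S \<inter> vec.span B) = 0"
      using dimS spB by (simp add: card_cart_basis)
    then show ?thesis by simp
  qed
  have inj: "inj_on ((*v) A) ?S"
  proof (rule inj_onI)
    fix x y assume xy: "x \<in> ?S" "y \<in> ?S" "A *v x = A *v y"
    then have "x - y \<in> ?S" "A *v (x - y) = 0"
      by (auto simp: vec.span_diff matrix_vector_mult_diff_distrib)
    then show "x = y" using int0 spB by auto
  qed
  have "range ((*v) A) = (*v) A ` ?S"
  proof
    show "range ((*v) A) \<subseteq> (*v) A ` ?S"
    proof
      fix b assume "b \<in> range ((*v) A)"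
      then obtain x where x: "b = A *v x" by auto
      have "x \<in> vec.span ((D - B) \<union> B)" using D by (simp add: Un_absorb2)
      then obtain y z where yz: "x = y + z" "y \<in> ?S" "z \<in> vec.span B"
        unfolding vec.span_Un by blast
      then have "b = A *v y" using x spB by (simp add: matrix_vector_right_distrib)
      then show "b \<in> (*v) A ` ?S" using yz by auto
    qed
  qed auto
  moreover have "vec.dim ((*v) A ` ?S) = vec.dim ?S"
    using inj by (intro vec.dim_image_eq) (simp_all add: vec.span_span)
  ultimately show ?thesis using dimS by simp
qed

text \<open>The kernel is cut out by the vectors of a basis of the row space, and each of these
  linear conditions lowers the dimension by at most one.\<close>

lemma nullity_ge_card_minus_rank:
  fixes A :: "'a::field^'n^'m"
  shows "CARD('n) \<le> vec.dim {x. A *v x = 0} + rank A"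
proof -
  obtain B where B: "B \<subseteq> rows A" "vec.independent B" "rows A \<subseteq> vec.span B" "card B = vec.dim (rows A)"
    using vec.basis_exists by blast
  define dt where "dt = (\<lambda>(b::'a^'n) x. \<Sum>i\<in>UNIV. b$i * x$i)"
  have dt_add: "dt b (x + y) = dt b x + dt b y" and dt_scale: "dt b (c *s x) = c * dt b x" for b x y c
    by (auto simp: dt_def algebra_simps sum.distrib sum_distrib_left)
  have finB: "finite B" using B(2) vec.finiteI_independent by auto
  have "CARD('n) \<le> vec.dim {x. \<forall>b\<in>B. dt b x = 0} + card B"
    using finB
  proof (induction B rule: finite_induct)
    case empty
    then show ?case by (simp add: card_cart_basis)
  next
    case (insert b B)
    have "vec.subspace {x. \<forall>b\<in>B. dt b x = 0}"
      by (auto simp: vec.subspace_def dt_add dt_scale) (simp add: dt_def)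
    then have "vec.dim {x. \<forall>b\<in>B. dt b x = 0} \<le> vec.dim ({x. \<forall>b\<in>B. dt b x = 0} \<inter> {x. dt b x = 0}) + 1"
      by (rule dim_functional_kernel_le) (simp_all add: dt_add dt_scale)
    moreover have "{x. \<forall>b\<in>B. dt b x = 0} \<inter> {x. dt b x = 0} = {x. \<forall>c\<in>insert b B. dt c x = 0}" by auto
    ultimately show ?case using insert by simp
  qed
  moreover have "{x. \<forall>b\<in>B. dt b x = 0} \<subseteq> {x. A *v x = 0}"
  proof
    fix x assume x: "x \<in> {x. \<forall>b\<in>B. dt b x = 0}"
    have "vec.subspace {b. dt b x = 0}"
      by (auto simp: vec.subspace_def dt_def algebra_simps sum.distrib simp flip: sum_distrib_left)
    moreover have "B \<subseteq> {b. dt b x = 0}" using x by auto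
    ultimately have "vec.span B \<subseteq> {b. dt b x = 0}" by (rule vec.span_minimal[rotated])
    then have "dt (row i A) x = 0" for i using B(3) by (auto simp: rows_def)
    then show "x \<in> {x. A *v x = 0}"
      by (auto simp: vec_eq_iff matrix_vector_mult_def dt_def row_def)
  qed
  then have "vec.dim {x. \<forall>b\<in>B. dt b x = 0} \<le> vec.dim {x. A *v x = 0}"
    by (rule vec.dim_subset)
  ultimately show ?thesis using B(4) by (simp add: row_rank_def_gen)
qed

text \<open>The lower bound for the nullity bounds the column rank by the row rank; the transpose gives the
  converse.\<close>

lemma rank_eq_card_minus_nullity:
  fixes A :: "'a::field^'n^'n"
  shows "rank A + vec.dim {x. A *v x = 0} = CARD('n)"
proof -
  have cols: "vec.dim (range ((*v) B)) = rank (transpose B)" for B :: "'a^'n^'n"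
  proof -
    have "range ((*v) B) = vec.span (columns B)"
    proof
      show "range ((*v) B) \<subseteq> vec.span (columns B)"
      proof
        fix b assume "b \<in> range ((*v) B)"
        then obtain x where "b = B *v x" by auto
        then have "b = (\<Sum>i\<in>UNIV. (x$i) *s column i B)"
          by (simp add: matrix_mult_sum)
        moreover have "(\<Sum>i\<in>UNIV. (x$i) *s column i B) \<in> vec.span (columns B)"
          by (intro vec.span_sum vec.span_scale vec.span_base) (auto simp: columns_def)
        ultimately show "b \<in> vec.span (columns B)" by simp
      qed
      have "vec.subspace (range ((*v) B))"
        using vec.subspace_UNIV by (intro vec.subspace_image) auto
      moreover have "columns B \<subseteq> range ((*v) B)"
      proof -
        have "column i B = B *v axis i 1" for i
          by (simp add: vec_eq_iff mult_vec_axis column_def)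
        then show ?thesis unfolding columns_def by auto
      qed
      ultimately show "vec.span (columns B) \<subseteq> range ((*v) B)"
        by (rule vec.span_minimal[rotated])
    qed
    then show ?thesis by (simp add: row_rank_def_gen rows_transpose)
  qed
  have "rank (transpose B) \<le> rank B" for B :: "'a^'n^'n"
    using nullity_ge_card_minus_rank[of B] vec_rank_nullity[of B] cols[of B] by simp
  from this[of A] this[of "transpose A"] have "rank (transpose A) = rank A" by simp
  then show ?thesis using vec_rank_nullity[of A] cols[of A] by simp
qed

section \<open>Kernels of principal submatrices\<close>

text \<open>Kernel vectors of principal submatrices are extended by zero, so that submatrices of all
  sizes share one vector type and no reindexing occurs.\<close>

definition kernel_on :: "'a::field^'v^'v \<Rightarrow> 'v set \<Rightarrow> ('a^'v) set" where
  "kernel_on M W = {q. (\<forall>v. v \<notin> W \<longrightarrow> q $ v = 0) \<and> (\<forall>v\<in>W. (M *v q) $ v = 0)}"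

definition nullity_on :: "'a::field^'v^'v \<Rightarrow> 'v set \<Rightarrow> nat" where
  "nullity_on M W = vec.dim (kernel_on M W)"

lemma rank_eq_card_minus_nullity_on:
  fixes M :: "'a::field^'v^'v"
  shows "rank M + nullity_on M UNIV = CARD('v)"
  using rank_eq_card_minus_nullity[of M]
  by (simp add: nullity_on_def kernel_on_def vec_eq_iff)

lemma axis_1_nth: "axis u (1::'a::zero_neq_one) $ v = (if v = u then 1 else 0)"
  by (simp add: axis_def)

lemma mult_vec_eq_0:
  fixes M :: "'a::field^'n^'m"
  assumes "\<And>u. q $ u \<noteq> 0 \<Longrightarrow> M $ v $ u = 0"
  shows "(M *v q) $ v = 0"
  unfolding matrix_vector_mult_def using assms by (auto intro!: sum.neutral)

lemma subspace_kernel_on: "vec.subspace (kernel_on M W)"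
  by (auto simp: vec.subspace_def kernel_on_def mult_vec_add mult_vec_scale)

text \<open>Vanishing at \<open>x\<close> is a single linear condition, and kernel vectors that
  satisfy it are kernel vectors of the smaller matrix. The next lemma argues in the same way with
  the equation at \<open>x\<close> in place of the coordinate.\<close>

lemma nullity_on_le_delete:
  assumes "x \<in> W"
  shows "nullity_on M W \<le> nullity_on M (W - {x}) + 1"
proof -
  have "nullity_on M W \<le> vec.dim (kernel_on M W \<inter> {q. q $ x = 0}) + 1"
    unfolding nullity_on_def by (rule dim_functional_kernel_le[OF subspace_kernel_on]) simp_all
  moreover
  have "kernel_on M W \<inter> {q. q $ x = 0} \<subseteq> kernel_on M (W - {x})"
    by (auto simp: kernel_on_def)
  from vec.dim_subset[OF this] have "vec.dim (kernel_on M W \<inter> {q. q $ x = 0}) \<le> nullity_on M (W - {x})"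
    by (simp add: nullity_on_def)
  ultimately show ?thesis by linarith
qed

lemma nullity_on_delete_le:
  assumes "x \<in> W"
  shows "nullity_on M (W - {x}) \<le> nullity_on M W + 1"
proof -
  have "nullity_on M (W - {x}) \<le> vec.dim (kernel_on M (W - {x}) \<inter> {q. (M *v q) $ x = 0}) + 1"
    unfolding nullity_on_def
    by (rule dim_functional_kernel_le[OF subspace_kernel_on]) (simp_all add: mult_vec_add mult_vec_scale)
  moreover
  have "kernel_on M (W - {x}) \<inter> {q. (M *v q) $ x = 0} \<subseteq> kernel_on M W"
    using assms by (auto simp: kernel_on_def)
  from vec.dim_subset[OF this] have "vec.dim (kernel_on M (W - {x}) \<inter> {q. (M *v q) $ x = 0}) \<le> nullity_on M (W)"
    by (simp add: nullity_on_def)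
  ultimately show ?thesis by linarith
qed

text \<open>The vector \<open>q\<close> shows that the equation at \<open>y\<close> is a proper
  condition on the smaller kernel and costs a dimension; allowing a value at \<open>y\<close>
  regains at most one. This is the source of the final contradiction for edges that leave a
  cycle.\<close>

lemma nullity_on_delete_ge:
  assumes "y \<in> W" "q \<in> kernel_on M (W - {y})" "(M *v q) $ y \<noteq> 0"
  shows "nullity_on M W \<le> nullity_on M (W - {y})"
proof -
  have "nullity_on M (W - {y}) = vec.dim (kernel_on M (W - {y}) \<inter> {q. (M *v q) $ y = 0}) + 1"
    unfolding nullity_on_def
    by (rule dim_functional_kernel[OF subspace_kernel_on]) (use assms in \<open>simp_all add: mult_vec_add mult_vec_scale\<close>)
  moreover have "nullity_on M W \<le> vec.dim (kernel_on M W \<inter> {q. q $ y = 0}) + 1"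
    unfolding nullity_on_def by (rule dim_functional_kernel_le[OF subspace_kernel_on]) simp_all
  moreover have "vec.dim (kernel_on M W \<inter> {q. q $ y = 0})
      \<le> vec.dim (kernel_on M (W - {y}) \<inter> {q. (M *v q) $ y = 0})"
    using assms(1) by (intro vec.dim_subset) (auto simp: kernel_on_def)
  ultimately show ?thesis by linarith
qed

lemma nullity_on_isolated:
  fixes M :: "'a::field^'v^'v"
  assumes "x \<in> W" and col: "\<And>v. v \<in> W \<Longrightarrow> M $ v $ x = 0" and row: "\<And>v. v \<in> W \<Longrightarrow> M $ x $ v = 0"
  shows "nullity_on M W = nullity_on M (W - {x}) + 1"
proof -
  have "axis x 1 \<in> kernel_on M W"
    using assms by (auto simp: kernel_on_def mult_vec_axis axis_1_nth split: if_splits)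
  then have "nullity_on M W = vec.dim (kernel_on M W \<inter> {q. q $ x = 0}) + 1"
    unfolding nullity_on_def by (rule dim_functional_kernel[OF subspace_kernel_on, rotated 2]) (simp_all add: axis_1_nth)
  moreover have "kernel_on M W \<inter> {q. q $ x = 0} = kernel_on M (W - {x})"
  proof -
    have "(M *v q) $ x = 0" if "q \<in> kernel_on M (W - {x})" for q
      using that row by (intro mult_vec_eq_0) (auto simp: kernel_on_def)
    then show ?thesis using assms(1) by (auto simp: kernel_on_def)
  qed
  ultimately show ?thesis by (simp add: nullity_on_def)
qed

text \<open>The equation at \<open>u\<close> forces the coordinate at \<open>v\<close> to vanish.
  Deleting \<open>v\<close> isolates \<open>u\<close>, which contributes one dimension; the equation
  at \<open>v\<close> takes it away again, as it fails for the unit vector at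
  \<open>u\<close>.\<close>

lemma nullity_on_pendant:
  fixes M :: "'a::field^'v^'v"
  assumes "u \<in> W" "v \<in> W" "u \<noteq> v" and col: "\<And>w. w \<in> W \<Longrightarrow> w \<noteq> v \<Longrightarrow> M $ w $ u = 0"
    and row: "\<And>w. w \<in> W \<Longrightarrow> w \<noteq> v \<Longrightarrow> M $ u $ w = 0" and nz: "M $ u $ v \<noteq> 0" "M $ v $ u \<noteq> 0"
  shows "nullity_on M W = nullity_on M (W - {u, v})"
proof -
  have "nullity_on M (W - {v}) = nullity_on M (W - {v} - {u}) + 1"
    using assms by (intro nullity_on_isolated) auto
  moreover have "W - {v} - {u} = W - {u, v}" by auto
  moreover have "nullity_on M (W - {v}) = vec.dim (kernel_on M (W - {v}) \<inter> {q. (M *v q) $ v = 0}) + 1"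
  proof -
    have "axis u 1 \<in> kernel_on M (W - {v})"
      using assms by (auto simp: kernel_on_def mult_vec_axis axis_1_nth split: if_splits)
    then show ?thesis
      unfolding nullity_on_def using nz
      by (intro dim_functional_kernel[OF subspace_kernel_on])
        (auto simp: mult_vec_add mult_vec_scale mult_vec_axis)
  qed
  moreover have "kernel_on M (W - {v}) \<inter> {q. (M *v q) $ v = 0} = kernel_on M W"
  proof -
    have "q $ v = 0" if q: "q \<in> kernel_on M W" for q
    proof -
      have "M $ u $ w * q $ w = 0" if "w \<noteq> v" for w
        using q row[of w] that by (cases "w \<in> W") (auto simp: kernel_on_def)
      then have "(\<Sum>w\<in>UNIV. M $ u $ w * q $ w) = (\<Sum>w\<in>{v}. M $ u $ w * q $ w)"
        by (intro sum.mono_neutral_right) auto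
      then have "(M *v q) $ u = (\<Sum>w\<in>{v}. M $ u $ w * q $ w)"
        by (simp add: matrix_vector_mult_def)
      then show ?thesis using q nz \<open>u \<in> W\<close> by (simp add: kernel_on_def)
    qed
    then show ?thesis using \<open>v \<in> W\<close> by (auto simp: kernel_on_def)
  qed
  ultimately show ?thesis by (simp add: nullity_on_def)
qed

lemma nullity_on_Un:
  fixes M :: "'a::field^'v^'v"
  assumes "W1 \<inter> W2 = {}" and "\<And>u v. u \<in> W1 \<Longrightarrow> v \<in> W2 \<Longrightarrow> M $ u $ v = 0 \<and> M $ v $ u = 0"
  shows "nullity_on M (W1 \<union> W2) = nullity_on M W1 + nullity_on M W2"
proof -
  have "kernel_on M (W1 \<union> W2) = {x + y |x y. x \<in> kernel_on M W1 \<and> y \<in> kernel_on M W2}"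
  proof (intro set_eqI iffI)
    fix q assume q: "q \<in> kernel_on M (W1 \<union> W2)"
    define x where "x = (\<chi> v. if v \<in> W1 then q $ v else 0)"
    define y where "y = (\<chi> v. if v \<in> W2 then q $ v else 0)"
    have qxy: "q = x + y"
      using q assms(1) by (auto simp: vec_eq_iff x_def y_def kernel_on_def)
    have y1: "(M *v y) $ v = 0" if "v \<in> W1" for v
      using that assms by (intro mult_vec_eq_0) (auto simp: y_def split: if_splits)
    have x2: "(M *v x) $ v = 0" if "v \<in> W2" for v
      using that assms by (intro mult_vec_eq_0) (auto simp: x_def split: if_splits)
    have "x \<in> kernel_on M W1" "y \<in> kernel_on M W2"
    proof -
      have "(M *v x) $ v = 0" if "v \<in> W1" for v
        using q that y1[OF that] mult_vec_add[of M x y v] unfolding kernel_on_def qxy by auto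
      moreover have "(M *v y) $ v = 0" if "v \<in> W2" for v
        using q that x2[OF that] mult_vec_add[of M x y v] unfolding kernel_on_def qxy by auto
      ultimately show "x \<in> kernel_on M W1" "y \<in> kernel_on M W2"
        by (simp_all add: kernel_on_def) (simp_all add: x_def y_def)
    qed
    then show "q \<in> {x + y |x y. x \<in> kernel_on M W1 \<and> y \<in> kernel_on M W2}" using qxy by blast
  next
    fix q assume "q \<in> {x + y |x y. x \<in> kernel_on M W1 \<and> y \<in> kernel_on M W2}"
    then obtain x y where xy: "q = x + y" "x \<in> kernel_on M W1" "y \<in> kernel_on M W2" by auto
    have y1: "(M *v y) $ v = 0" if "v \<in> W1" for v
      using that assms(2)[of v] xy by (intro mult_vec_eq_0) (auto simp: kernel_on_def)
    have x2: "(M *v x) $ v = 0" if "v \<in> W2" for v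
      using that assms(2)[of _ v] xy by (intro mult_vec_eq_0) (auto simp: kernel_on_def)
    show "q \<in> kernel_on M (W1 \<union> W2)"
      using xy y1 x2 by (auto simp: kernel_on_def mult_vec_add)
  qed
  moreover have "vec.dim (kernel_on M W1 \<inter> kernel_on M W2) = 0"
    unfolding vec.dim_eq_0
  proof
    fix q assume "q \<in> kernel_on M W1 \<inter> kernel_on M W2"
    then have "q $ v = 0" for v
      using assms(1) by (cases "v \<in> W1") (auto simp: kernel_on_def)
    then show "q \<in> {0}" by (simp add: vec_eq_iff)
  qed
  ultimately show ?thesis
    using vec.dim_sums_Int[OF subspace_kernel_on subspace_kernel_on, of M W1 M W2]
    by (simp add: nullity_on_def del: vec.dim_eq_0)
qed

lemma nullity_on_empty [simp]: "nullity_on M {} = 0"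
  by (auto simp: nullity_on_def kernel_on_def vec_eq_iff)

section \<open>The cyclomatic number\<close>

abbreviation adj :: "'v set set \<Rightarrow> ('v \<times> 'v) set" where
  "adj E \<equiv> {(x, y). {x, y} \<in> E}"

lemma sym_adj: "sym (adj E)"
  by (auto simp: sym_def insert_commute)

lemma adj_rtrancl_sym: "(x, y) \<in> (adj E)\<^sup>* \<Longrightarrow> (y, x) \<in> (adj E)\<^sup>*"
  by (rule symD[OF sym_rtrancl[OF sym_adj]])

lemma adj_rtrancl_mono: "E \<subseteq> E' \<Longrightarrow> (x, y) \<in> (adj E)\<^sup>* \<Longrightarrow> (x, y) \<in> (adj E')\<^sup>*"
  using rtrancl_mono[of "adj E" "adj E'"] by auto

lemma equiv_connected_rel: "equiv (fst G) (connected_rel G)"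
  by (rule equivI)
    (auto simp: connected_rel_def refl_on_def sym_def trans_def dest: adj_rtrancl_sym)

lemma finite_components: "finite (fst G) \<Longrightarrow> finite (fst G // connected_rel G)"
  by (rule finite_quotient) (auto simp: connected_rel_def)

lemma simple_graph_finite_edges: "simple_graph G \<Longrightarrow> finite (snd G)"
  by (rule finite_subset[of _ "Pow (fst G)"]) (auto simp: simple_graph_def)

lemma simple_graph_subset_edges: "simple_graph (V, E) \<Longrightarrow> F \<subseteq> E \<Longrightarrow> simple_graph (V, F)"
  by (auto simp: simple_graph_def)

lemma simple_graph_edgeD:
  assumes "simple_graph G" "{x, y} \<in> snd G"
  shows "x \<noteq> y" "x \<in> fst G" "y \<in> fst G"
proof -
  have "card {x, y} = 2" "{x, y} \<subseteq> fst G" using assms by (auto simp: simple_graph_def)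
  then show "x \<noteq> y" "x \<in> fst G" "y \<in> fst G" by (auto simp: card_insert_if split: if_splits)
qed

lemma simple_graph_edgeE:
  assumes "simple_graph G" "e \<in> snd G"
  obtains x y where "e = {x, y}" "x \<noteq> y"
  using assms by (auto simp: simple_graph_def card_2_iff)

text \<open>The parts of a walk before its first and after its last use of the edge
  \<open>{u, v}\<close> avoid this edge.\<close>

lemma rtrancl_adj_delete_edge:
  assumes "(a, y) \<in> (adj E)\<^sup>*"
  shows "(a, y) \<in> (adj (E - {{u, v}}))\<^sup>* \<or>
    ((a, u) \<in> (adj (E - {{u, v}}))\<^sup>* \<or> (a, v) \<in> (adj (E - {{u, v}}))\<^sup>*) \<and>
    ((y, u) \<in> (adj (E - {{u, v}}))\<^sup>* \<or> (y, v) \<in> (adj (E - {{u, v}}))\<^sup>*)"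
  using assms
proof (induction rule: rtrancl_induct)
  case base
  then show ?case by simp
next
  case (step y z)
  let ?R = "(adj (E - {{u, v}}))\<^sup>*"
  show ?case
  proof (cases "{y, z} = {u, v}")
    case True
    then have "(y = u \<or> y = v) \<and> (z = u \<or> z = v)" by (auto simp: doubleton_eq_iff)
    then show ?thesis using step.IH by auto
  next
    case False
    then have yz: "(y, z) \<in> ?R" using step.hyps by auto
    have "(z, w) \<in> ?R" if "(y, w) \<in> ?R" for w
      using adj_rtrancl_sym[OF yz] that by (rule rtrancl_trans)
    moreover have "(a, z) \<in> ?R" if "(a, y) \<in> ?R"
      using that yz by (rule rtrancl_trans)
    ultimately show ?thesis using step.IH by blast
  qed
qed

lemma cyclomatic_number_delete_nonbridge:
  assumes G: "simple_graph (V, E)" and e: "{u, v} \<in> E"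
    and con: "(u, v) \<in> (adj (E - {{u, v}}))\<^sup>*"
  shows "cyclomatic_number (V, E - {{u, v}}) = cyclomatic_number (V, E) - 1"
proof -
  have "(adj (E - {{u, v}}))\<^sup>* = (adj E)\<^sup>*"
  proof
    show "(adj (E - {{u, v}}))\<^sup>* \<subseteq> (adj E)\<^sup>*" by (rule rtrancl_mono) auto
    show "(adj E)\<^sup>* \<subseteq> (adj (E - {{u, v}}))\<^sup>*"
    proof clarify
      fix x y assume "(x, y) \<in> (adj E)\<^sup>*"
      note xy = rtrancl_adj_delete_edge[OF this, of u v]
      define R where "R = (adj (E - {{u, v}}))\<^sup>*"
      have "(a, b) \<in> R \<Longrightarrow> (b, a) \<in> R" "(a, b) \<in> R \<Longrightarrow> (b, z) \<in> R \<Longrightarrow> (a, z) \<in> R" for a b z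
        unfolding R_def by (rule adj_rtrancl_sym, assumption) (rule rtrancl_trans)
      then show "(x, y) \<in> (adj (E - {{u, v}}))\<^sup>*"
        using xy con unfolding R_def[symmetric] by metis
    qed
  qed
  then have "num_components (V, E - {{u, v}}) = num_components (V, E)"
    by (simp add: num_components_def connected_rel_def)
  moreover have "finite E" using simple_graph_finite_edges[OF G] by simp
  then have "int (card (E - {{u, v}})) = int (card E) - 1"
    using e by (metis Suc_pred card_Diff_singleton card_gt_0_iff empty_iff of_nat_1 of_nat_diff One_nat_def Suc_leI)
  ultimately show ?thesis by (simp add: cyclomatic_number_def)
qed

text \<open>At most one component is gained. Two distinct new components that merge once
  \<open>e = {u, v}\<close> is restored are those of \<open>u\<close> and of \<open>v\<close>; so
  the new components other than that of \<open>u\<close> inject into the old ones.\<close>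

lemma cyclomatic_number_delete_edge_le:
  assumes G: "simple_graph (V, E)" and e: "e \<in> E"
  shows "cyclomatic_number (V, E - {e}) \<le> cyclomatic_number (V, E)"
proof -
  obtain u v where uv: "e = {u, v}" "u \<noteq> v" using simple_graph_edgeE[OF G] e by auto
  let ?R = "connected_rel (V, E)" and ?R' = "connected_rel (V, E - {e})"
  have V: "u \<in> V" "v \<in> V" "finite V" using G e uv by (auto simp: simple_graph_def)
  have sub: "?R' \<subseteq> ?R"
    using adj_rtrancl_mono[of "E - {e}" E] by (auto simp: connected_rel_def)
  have eqR: "equiv V ?R" and eqR': "equiv V ?R'"
    using equiv_connected_rel[of "(V, E)"] equiv_connected_rel[of "(V, E - {e})"] by auto
  let ?Q' = "V // ?R' - {?R' `` {u}}"
  have R_class: "?R `` (?R' `` {a}) = ?R `` {a}" if "a \<in> V" for a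
    using sub eqR eqR' that unfolding equiv_def trans_def refl_on_def by blast
  have "card ?Q' \<le> card (V // ?R)"
  proof (rule card_inj_on_le)
    show "inj_on (\<lambda>X. ?R `` X) ?Q'"
    proof (rule inj_onI)
      fix X Y assume X: "X \<in> ?Q'" and Y: "Y \<in> ?Q'" and XY: "?R `` X = ?R `` Y"
      obtain a where a: "a \<in> V" "X = ?R' `` {a}" using X by (auto elim: quotientE)
      obtain b where b: "b \<in> V" "Y = ?R' `` {b}" using Y by (auto elim: quotientE)
      have "(a, b) \<in> ?R"
        using XY a b R_class eq_equiv_class_iff[OF eqR] by auto
      then have ab: "(a, b) \<in> (adj E)\<^sup>*" by (simp add: connected_rel_def)
      have nau: "(a, u) \<notin> (adj (E - {e}))\<^sup>*"
        using X a V eq_equiv_class_iff[OF eqR', of a u] by (auto simp: connected_rel_def)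
      have nbu: "(b, u) \<notin> (adj (E - {e}))\<^sup>*"
        using Y b V eq_equiv_class_iff[OF eqR', of b u] by (auto simp: connected_rel_def)
      have "(a, b) \<in> (adj (E - {e}))\<^sup>*"
      proof -
        have "(a, b) \<in> (adj (E - {e}))\<^sup>* \<or> (a, v) \<in> (adj (E - {e}))\<^sup>* \<and> (b, v) \<in> (adj (E - {e}))\<^sup>*"
          using rtrancl_adj_delete_edge[OF ab, of u v] nau nbu unfolding uv(1)[symmetric] by blast
        then show ?thesis
          by (elim disjE conjE) (assumption, erule rtrancl_trans, erule adj_rtrancl_sym)
      qed
      then have "(a, b) \<in> ?R'" using a b by (simp add: connected_rel_def)
      then show "X = Y" using a b equiv_class_eq[OF eqR'] by auto
    qed
    show "(\<lambda>X. ?R `` X) ` ?Q' \<subseteq> V // ?R"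
      using R_class by (auto elim!: quotientE intro: quotientI)
    show "finite (V // ?R)" using finite_components[of "(V, E)"] V by simp
  qed
  moreover have "card ?Q' = card (V // ?R') - 1"
    using V by (simp add: card_Diff_singleton quotientI)
  ultimately have "num_components (V, E - {e}) \<le> num_components (V, E) + 1"
    by (simp add: num_components_def)
  moreover have "finite E" using simple_graph_finite_edges[OF G] by simp
  then have "int (card (E - {e})) = int (card E) - 1"
    using e by (metis Suc_pred card_Diff_singleton card_gt_0_iff empty_iff of_nat_1 of_nat_diff One_nat_def Suc_leI)
  ultimately show ?thesis by (simp add: cyclomatic_number_def)
qed

lemma cyclomatic_number_mono_edges:
  assumes "simple_graph (V, E)" "F \<subseteq> E"
  shows "cyclomatic_number (V, F) \<le> cyclomatic_number (V, E)"
proof -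
  have "finite (E - F)" using simple_graph_finite_edges[OF assms(1)] by simp
  have "cyclomatic_number (V, E - D) \<le> cyclomatic_number (V, E)" if "finite D" "D \<subseteq> E" for D
    using that
  proof (induction D rule: finite_induct)
    case empty
    then show ?case by simp
  next
    case (insert e D)
    have "E - insert e D = E - D - {e}" by auto
    moreover have "cyclomatic_number (V, E - D - {e}) \<le> cyclomatic_number (V, E - D)"
      using insert by (intro cyclomatic_number_delete_edge_le simple_graph_subset_edges[OF assms(1)]) auto
    ultimately show ?case using insert by simp
  qed
  from this[OF \<open>finite (E - F)\<close>] have "cyclomatic_number (V, E - (E - F)) \<le> cyclomatic_number (V, E)"
    by auto
  moreover have "E - (E - F) = F" using assms(2) by auto
  ultimately show ?thesis by simp
qed

lemma cyclomatic_number_no_edges: "finite V \<Longrightarrow> cyclomatic_number (V, {}) = 0"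
proof -
  have "V // connected_rel (V, {}) = (\<lambda>a. {a}) ` V"
    by (auto simp: quotient_def connected_rel_def)
  then have "num_components (V, {}) = card V"
    by (simp add: num_components_def card_image)
  then show ?thesis by (simp add: cyclomatic_number_def)
qed

lemma cyclomatic_number_nonneg: "simple_graph G \<Longrightarrow> 0 \<le> cyclomatic_number G"
  using cyclomatic_number_mono_edges[of "fst G" "snd G" "{}"] cyclomatic_number_no_edges[of "fst G"]
  by (simp add: simple_graph_def)

lemma cyclomatic_number_delete_isolated:
  assumes "finite V" "x \<in> V" and iso: "\<And>e. e \<in> E \<Longrightarrow> x \<notin> e"
  shows "cyclomatic_number (V - {x}, E) = cyclomatic_number (V, E)"
proof -
  have nx: "(a, x) \<in> (adj E)\<^sup>* \<Longrightarrow> a = x" for a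
    using iso by (erule_tac rtranclE) auto
  have nx': "(x, a) \<in> (adj E)\<^sup>* \<Longrightarrow> a = x" for a
    using nx adj_rtrancl_sym by metis
  let ?R = "connected_rel (V, E)" and ?R' = "connected_rel (V - {x}, E)"
  have cl: "?R `` {a} = ?R' `` {a}" if "a \<in> V - {x}" for a
    using nx that by (auto simp: connected_rel_def)
  have clx: "?R `` {x} = {x}"
    using nx' assms(2) by (auto simp: connected_rel_def)
  have "V // ?R = insert {x} ((V - {x}) // ?R')"
  proof -
    have "V // ?R = (\<lambda>a. ?R `` {a}) ` insert x (V - {x})"
      using assms(2) by (simp add: quotient_def insert_absorb UNION_singleton_eq_range)
    also have "\<dots> = insert {x} ((\<lambda>a. ?R' `` {a}) ` (V - {x}))"
      using cl clx by (metis (no_types, lifting) image_cong image_insert)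
    finally show ?thesis by (simp add: quotient_def UNION_singleton_eq_range)
  qed
  moreover have "{x} \<notin> (V - {x}) // ?R'"
    by (auto simp: quotient_def connected_rel_def)
  moreover have "finite ((V - {x}) // ?R')"
    using finite_components[of "(V - {x}, E)"] assms(1) by simp
  ultimately have "num_components (V, E) = num_components (V - {x}, E) + 1"
    by (simp add: num_components_def)
  moreover have "int (card (V - {x})) = int (card V) - 1"
    using assms by (metis Suc_pred card_Diff_singleton card_gt_0_iff empty_iff of_nat_1 of_nat_diff One_nat_def Suc_leI)
  ultimately show ?thesis by (simp add: cyclomatic_number_def)
qed

text \<open>\<open>F\<close> is meant to contain the edges at \<open>x\<close> whose loss can be
  evaluated exactly. Removing the other edges at \<open>x\<close> never raises the number, and
  dropping \<open>x\<close> once it is isolated leaves it unchanged.\<close>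

lemma cyclomatic_number_delete_vertex_le:
  assumes G: "simple_graph (V, E)" and "x \<in> V" and F: "\<And>e. e \<in> F \<Longrightarrow> x \<in> e"
  shows "cyclomatic_number (induced_subgraph (V, E) (V - {x})) \<le> cyclomatic_number (V, E - F)"
proof -
  let ?E = "{e \<in> E. x \<notin> e}"
  have "induced_subgraph (V, E) (V - {x}) = (V - {x}, ?E)"
    using G by (auto simp: induced_subgraph_def simple_graph_def)
  moreover have "cyclomatic_number (V - {x}, ?E) = cyclomatic_number (V, ?E)"
    using assms by (intro cyclomatic_number_delete_isolated) (auto simp: simple_graph_def)
  moreover have "cyclomatic_number (V, ?E) \<le> cyclomatic_number (V, E - F)"
    using F by (intro cyclomatic_number_mono_edges simple_graph_subset_edges[OF G]) auto
  ultimately show ?thesis by simp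
qed

section \<open>Cycles\<close>

text \<open>Reading indices modulo the length lets walks and recurrences run over all natural
  numbers without a separate case at the end of the list.\<close>

definition vtx :: "'v list \<Rightarrow> nat \<Rightarrow> 'v" where
  "vtx c i = c ! (i mod length c)"

lemma vtx_eq_iff:
  "distinct c \<Longrightarrow> c \<noteq> [] \<Longrightarrow> vtx c i = vtx c j \<longleftrightarrow> i mod length c = j mod length c"
  by (simp add: vtx_def nth_eq_iff_index_eq)

lemma vtx_add_length [simp]: "vtx c (i + length c) = vtx c i" "vtx c (length c + i) = vtx c i"
  by (simp_all add: vtx_def)

lemma vtx_nth: "i < length c \<Longrightarrow> vtx c i = c ! i"
  by (simp add: vtx_def)

lemma next_vertex_eq_vtx: "next_vertex c i = vtx c (Suc i)"
  by (simp add: next_vertex_def vtx_def)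

lemma vtx_in_set: "c \<noteq> [] \<Longrightarrow> vtx c i \<in> set c"
  by (simp add: vtx_def)

lemma in_set_vtx: "x \<in> set c \<Longrightarrow> \<exists>i < length c. x = vtx c i"
  by (auto simp: in_set_conv_nth vtx_def)

lemma vtx_Suc_mod: "vtx c (Suc (i mod length c)) = vtx c (Suc i)"
  by (simp add: vtx_def mod_Suc_eq)

lemma cycle_edges_eq_range: "c \<noteq> [] \<Longrightarrow> cycle_edges c = range (\<lambda>i. {vtx c i, vtx c (Suc i)})"
proof (intro set_eqI iffI)
  fix e assume "e \<in> cycle_edges c"
  then obtain i where "i < length c" "e = {c ! i, next_vertex c i}" by (auto simp: cycle_edges_def)
  then show "e \<in> range (\<lambda>i. {vtx c i, vtx c (Suc i)})"
    by (intro image_eqI[of _ _ i]) (auto simp: next_vertex_eq_vtx vtx_nth)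
next
  fix e assume c: "c \<noteq> []" "e \<in> range (\<lambda>i. {vtx c i, vtx c (Suc i)})"
  then obtain i where i: "e = {vtx c i, vtx c (Suc i)}" by auto
  then have "e = {c ! (i mod length c), next_vertex c (i mod length c)}"
    by (simp add: next_vertex_eq_vtx vtx_Suc_mod) (simp add: vtx_def)
  moreover have "i mod length c < length c" using c by simp
  ultimately show "e \<in> cycle_edges c" unfolding cycle_edges_def by blast
qed

lemma Union_cycle_edges: "c \<noteq> [] \<Longrightarrow> \<Union> (cycle_edges c) = set c"
  by (auto simp: cycle_edges_eq_range vtx_in_set dest: in_set_vtx)

lemma is_cycle_nonempty: "is_cycle G c \<Longrightarrow> c \<noteq> []"
  by (auto simp: is_cycle_def)

lemma cycle_edge_vertices:
  assumes "c \<noteq> []" "{u, v} \<in> cycle_edges c"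
  shows "u \<in> set c" "v \<in> set c"
  using Union_cycle_edges[OF assms(1)] assms(2) by auto

text \<open>Two different positions could only give the same edge traversed in opposite directions,
  which would make the length a divisor of 2.\<close>

lemma cycle_edge_eq_iff:
  assumes "distinct c" "3 \<le> length c"
  shows "{vtx c i, vtx c (Suc i)} = {vtx c j, vtx c (Suc j)} \<longleftrightarrow> i mod length c = j mod length c"
proof
  let ?l = "length c"
  have ne: "c \<noteq> []" using assms by auto
  assume eq: "{vtx c i, vtx c (Suc i)} = {vtx c j, vtx c (Suc j)}"
  show "i mod ?l = j mod ?l"
  proof (rule ccontr)
    assume "i mod ?l \<noteq> j mod ?l"
    then have "vtx c i \<noteq> vtx c j" using assms(1) ne by (simp add: vtx_eq_iff)
    then have "vtx c i = vtx c (Suc j)" "vtx c (Suc i) = vtx c j"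
      using eq by (auto simp: doubleton_eq_iff)
    then have 1: "i mod ?l = Suc j mod ?l" and 2: "Suc i mod ?l = j mod ?l"
      using assms(1) ne by (simp_all add: vtx_eq_iff)
    have "Suc (Suc j) mod ?l = j mod ?l" using 1 2 by (metis mod_Suc_eq)
    then have "?l dvd Suc (Suc j) - j" by (simp add: mod_eq_dvd_iff_nat)
    then have "?l dvd 2" by simp
    then show False using assms(2) by (auto dest: dvd_imp_le)
  qed
next
  assume "i mod length c = j mod length c"
  then show "{vtx c i, vtx c (Suc i)} = {vtx c j, vtx c (Suc j)}"
    by (metis vtx_def vtx_Suc_mod)
qed

text \<open>A cycle edge is not a bridge: from position \<open>Suc i\<close>, the
  \<open>length c - 1\<close> remaining steps lead round to position \<open>i\<close> again.\<close>

lemma cycle_edge_connected: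
  assumes "distinct c" "3 \<le> length c" and e: "{u, v} \<in> cycle_edges c"
  shows "(u, v) \<in> (adj (cycle_edges c - {{u, v}}))\<^sup>*"
proof -
  let ?l = "length c"
  have ne: "c \<noteq> []" using assms by auto
  obtain i where i: "{u, v} = {vtx c i, vtx c (Suc i)}"
    using e ne by (auto simp: cycle_edges_eq_range)
  let ?R = "adj (cycle_edges c - {{u, v}})"
  have "k \<le> ?l - 1 \<Longrightarrow> (vtx c (Suc i), vtx c (Suc i + k)) \<in> ?R\<^sup>*" for k
  proof (induction k)
    case 0
    then show ?case by simp
  next
    case (Suc k)
    have "i mod ?l \<noteq> (Suc i + k) mod ?l"
    proof
      assume "i mod ?l = (Suc i + k) mod ?l"
      then have "?l dvd (Suc i + k) - i" by (metis le_add1 mod_eq_dvd_iff_nat add_Suc_shift)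
      then have "?l dvd Suc k" by simp
      then show False using Suc.prems assms(2) by (auto dest: dvd_imp_le)
    qed
    then have "{vtx c (Suc i + k), vtx c (Suc (Suc i + k))} \<noteq> {u, v}"
      using cycle_edge_eq_iff[OF assms(1,2), of "Suc i + k" i] i by metis
    then have "(vtx c (Suc i + k), vtx c (Suc i + Suc k)) \<in> ?R"
      using ne by (auto simp: cycle_edges_eq_range)
    moreover have "(vtx c (Suc i), vtx c (Suc i + k)) \<in> ?R\<^sup>*" using Suc by simp
    ultimately show ?case by (rule rtrancl_into_rtrancl[rotated])
  qed
  from this[of "?l - 1"] have "(vtx c (Suc i), vtx c (Suc i + (?l - 1))) \<in> ?R\<^sup>*" by simp
  moreover have "Suc i + (?l - 1) = i + ?l" using assms(2) by simp
  ultimately have "(vtx c (Suc i), vtx c i) \<in> ?R\<^sup>*" by (metis vtx_add_length(1))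
  then have "(vtx c (Suc i), vtx c i) \<in> ?R\<^sup>*" "(vtx c i, vtx c (Suc i)) \<in> ?R\<^sup>*"
    using adj_rtrancl_sym by metis+
  moreover have "u = vtx c i \<and> v = vtx c (Suc i) \<or> u = vtx c (Suc i) \<and> v = vtx c i"
    using i by (auto simp: doubleton_eq_iff)
  ultimately show ?thesis by metis
qed

lemma cycle_vertices_connected:
  assumes "c \<noteq> []" "x \<in> set c" "y \<in> set c"
  shows "(x, y) \<in> (adj (cycle_edges c))\<^sup>*"
proof -
  have "(vtx c 0, vtx c k) \<in> (adj (cycle_edges c))\<^sup>*" for k
  proof (induction k)
    case (Suc k)
    have "(vtx c k, vtx c (Suc k)) \<in> adj (cycle_edges c)" using assms(1) by (auto simp: cycle_edges_eq_range)
    then show ?case using Suc by (rule rtrancl_into_rtrancl[rotated])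
  qed simp
  then have "(vtx c 0, x) \<in> (adj (cycle_edges c))\<^sup>*" "(vtx c 0, y) \<in> (adj (cycle_edges c))\<^sup>*"
    using in_set_vtx assms(2,3) by metis+
  from rtrancl_trans[OF adj_rtrancl_sym[OF this(1)] this(2)] show ?thesis .
qed

section \<open>Cycles and the cyclomatic number\<close>

lemma cyclomatic_number_delete_cycle_edge:
  assumes "simple_graph (V, E)" "is_cycle (V, E) c" "e \<in> cycle_edges c"
  shows "cyclomatic_number (V, E - {e}) = cyclomatic_number (V, E) - 1"
proof -
  have c: "distinct c" "3 \<le> length c" "cycle_edges c \<subseteq> E"
    using assms(2) by (auto simp: is_cycle_def)
  then have e: "e \<in> E" using assms(3) by auto
  obtain u v where uv: "e = {u, v}" using simple_graph_edgeE[OF assms(1), of e] e by (metis snd_conv)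
  have "(u, v) \<in> (adj (E - {{u, v}}))\<^sup>*"
    using cycle_edge_connected[OF c(1,2), of u v] assms(3) c(3) unfolding uv
    by (intro adj_rtrancl_mono[of "cycle_edges c - {{u, v}}" "E - {{u, v}}"]) auto
  then show ?thesis using cyclomatic_number_delete_nonbridge assms(1) e uv by metis
qed

lemma cyclomatic_number_delete_cycle_vertex:
  assumes G: "simple_graph (V, E)" and c: "is_cycle (V, E) c" and x: "x \<in> set c"
  shows "cyclomatic_number (induced_subgraph (V, E) (V - {x})) \<le> cyclomatic_number (V, E) - 1"
proof -
  obtain i where i: "x = vtx c i" using x in_set_vtx by metis
  have ne: "c \<noteq> []" using c by (auto simp: is_cycle_def)
  let ?e = "{vtx c i, vtx c (Suc i)}"
  have e: "?e \<in> cycle_edges c" using ne by (auto simp: cycle_edges_eq_range)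
  have "cyclomatic_number (induced_subgraph (V, E) (V - {x})) \<le> cyclomatic_number (V, E - {?e})"
    using G c x i by (intro cyclomatic_number_delete_vertex_le) (auto simp: is_cycle_def)
  then show ?thesis using cyclomatic_number_delete_cycle_edge[OF G c e] by simp
qed

text \<open>Otherwise, following \<open>c\<close> from a common vertex, every edge would belong to
  \<open>d\<close> and lead to the next common vertex, so that all of \<open>c\<close> would run
  inside \<open>d\<close>.\<close>

lemma intersecting_cycles_diverge:
  assumes "c \<noteq> []" "set c \<inter> set d \<noteq> {}" "\<not> cycle_edges c \<subseteq> cycle_edges d"
  obtains e x where "e \<in> cycle_edges c - cycle_edges d" "x \<in> e" "x \<in> set d" "x \<in> set c"
proof -
  have "\<exists>e x. e \<in> cycle_edges c - cycle_edges d \<and> x \<in> e \<and> x \<in> set d \<and> x \<in> set c"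
  proof (rule ccontr)
    assume H: "\<not> ?thesis"
    have d: "d \<noteq> []" using assms(2) by auto
    obtain s where s: "vtx c s \<in> set d" using assms(2) in_set_vtx by fastforce
    have edge: "{vtx c i, vtx c (Suc i)} \<in> cycle_edges d" if "vtx c i \<in> set d" for i
    proof (rule ccontr)
      assume "{vtx c i, vtx c (Suc i)} \<notin> cycle_edges d"
      then have "{vtx c i, vtx c (Suc i)} \<in> cycle_edges c - cycle_edges d"
        using assms(1) by (auto simp: cycle_edges_eq_range)
      then show False using H that assms(1) vtx_in_set by fastforce
    qed
    have all: "vtx c (s + k) \<in> set d" for k
    proof (induction k)
      case (Suc k)
      then have "{vtx c (s + k), vtx c (Suc (s + k))} \<in> cycle_edges d" by (rule edge)
      then show ?case using Union_cycle_edges[OF d] by auto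
    qed (simp add: s)
    have "vtx c i \<in> set d" for i
    proof -
      \<comment> \<open>Position \<open>i\<close> has to be written as \<open>s\<close> plus a
        natural number; adding \<open>s\<close> full turns keeps the subtraction from being
        truncated.\<close>
      have "vtx c (s + (i + s * length c - s)) = vtx c i"
      proof (cases "s \<le> i + s * length c")
        case True
        then show ?thesis by (simp add: vtx_def)
      next
        case False
        moreover have "s \<le> s * length c" using assms(1) by (cases c) auto
        ultimately show ?thesis by linarith
      qed
      then show ?thesis using all by metis
    qed
    then have "cycle_edges c \<subseteq> cycle_edges d"
      using edge assms(1) by (auto simp: cycle_edges_eq_range[of c])
    then show False using assms(3) by simp
  qed
  then show ?thesis using that by blast
qed

text \<open>At a vertex where two cycles diverge, an edge of the one cycle can be deleted without
  destroying the other, so that the cyclomatic number drops twice.\<close>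

lemma cyclomatic_number_delete_diverging_vertex:
  assumes G: "simple_graph (V, E)" and c: "is_cycle (V, E) c" and d: "is_cycle (V, E) d"
    and e: "e \<in> cycle_edges c - cycle_edges d" and x: "x \<in> e" "x \<in> set d"
  shows "cyclomatic_number (induced_subgraph (V, E) (V - {x})) \<le> cyclomatic_number (V, E) - 2"
proof -
  obtain i where i: "x = vtx d i" using x in_set_vtx by metis
  have ne: "d \<noteq> []" using d by (auto simp: is_cycle_def)
  let ?f = "{vtx d i, vtx d (Suc i)}"
  have f: "?f \<in> cycle_edges d" using ne by (auto simp: cycle_edges_eq_range)
  have "cyclomatic_number (induced_subgraph (V, E) (V - {x})) \<le> cyclomatic_number (V, E - {e, ?f})"
    using G d x i by (intro cyclomatic_number_delete_vertex_le) (auto simp: is_cycle_def)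
  moreover have "cyclomatic_number (V, E - {e}) = cyclomatic_number (V, E) - 1"
    using cyclomatic_number_delete_cycle_edge[OF G c] e by auto
  moreover have "cyclomatic_number (V, E - {e} - {?f}) = cyclomatic_number (V, E - {e}) - 1"
  proof (rule cyclomatic_number_delete_cycle_edge[OF _ _ f])
    show "simple_graph (V, E - {e})" by (rule simple_graph_subset_edges[OF G]) auto
    show "is_cycle (V, E - {e}) d" using d e by (auto simp: is_cycle_def)
  qed
  moreover have "E - {e} - {?f} = E - {e, ?f}" by auto
  ultimately show ?thesis by simp
qed

lemma intersecting_cycles_cyclomatic_number:
  assumes G: "simple_graph (V, E)" and nd: "\<not> vertex_disjoint (cycles (V, E))"
  obtains x c where "is_cycle (V, E) c" "x \<in> set c"
    "cyclomatic_number (induced_subgraph (V, E) (V - {x})) \<le> cyclomatic_number (V, E) - 2"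
proof -
  obtain c d where c: "is_cycle (V, E) c" and d: "is_cycle (V, E) d"
    and ne: "(set c, cycle_edges c) \<noteq> (set d, cycle_edges d)" and int: "set c \<inter> set d \<noteq> {}"
  proof -
    obtain C D where CD: "C \<in> cycles (V, E)" "D \<in> cycles (V, E)" "C \<noteq> D" "fst C \<inter> fst D \<noteq> {}"
      using nd unfolding vertex_disjoint_def by blast
    then obtain c d where "is_cycle (V, E) c" "C = (set c, cycle_edges c)"
      "is_cycle (V, E) d" "D = (set d, cycle_edges d)"
      unfolding cycles_def by blast
    then show ?thesis using that CD by simp
  qed
  have nil: "c \<noteq> []" "d \<noteq> []" using c d by (auto simp: is_cycle_def)
  then have "cycle_edges c \<noteq> cycle_edges d" using ne Union_cycle_edges by metis
  then consider "\<not> cycle_edges c \<subseteq> cycle_edges d" | "\<not> cycle_edges d \<subseteq> cycle_edges c" by auto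
  then show ?thesis
  proof cases
    case 1
    then obtain e x where "e \<in> cycle_edges c - cycle_edges d" "x \<in> e" "x \<in> set d" "x \<in> set c"
      using intersecting_cycles_diverge[OF nil(1) int] by blast
    then show ?thesis using that[OF c] cyclomatic_number_delete_diverging_vertex[OF G c d] by blast
  next
    case 2
    then obtain e x where "e \<in> cycle_edges d - cycle_edges c" "x \<in> e" "x \<in> set c" "x \<in> set d"
      using intersecting_cycles_diverge[OF nil(2), of c] int by blast
    then show ?thesis using that[OF d] cyclomatic_number_delete_diverging_vertex[OF G d c] by blast
  qed
qed

section \<open>Cycles obtained from paths\<close>

lemma is_cycleI_path:
  assumes "distinct p" "3 \<le> length p" "set p \<subseteq> V" "successively (\<lambda>a b. {a, b} \<in> E) p"
    "{last p, hd p} \<in> E"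
  shows "is_cycle (V, E) p" "{last p, hd p} \<in> cycle_edges p"
proof -
  have ne: "p \<noteq> []" using assms(2) by auto
  have succ: "{p ! i, p ! Suc i} \<in> E" if "Suc i < length p" for i
    using assms(4) that by (auto simp: successively_conv_nth)
  have lst: "{p ! (length p - 1), next_vertex p (length p - 1)} = {last p, hd p}"
    using ne by (simp add: next_vertex_def last_conv_nth hd_conv_nth)
  have "{p ! i, next_vertex p i} \<in> E" if "i < length p" for i
  proof (cases "Suc i < length p")
    case True
    then show ?thesis using succ by (simp add: next_vertex_def)
  next
    case False
    then have "i = length p - 1" using that by simp
    then show ?thesis using lst assms(5) by simp
  qed
  then show "is_cycle (V, E) p" using assms by (auto simp: is_cycle_def cycle_edges_def)
  show "{last p, hd p} \<in> cycle_edges p"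
    using lst ne unfolding cycle_edges_def by (metis (mono_tags, lifting) diff_less length_greater_0_conv mem_Collect_eq zero_less_one)
qed

lemma rtrancl_adj_path:
  assumes "(u, v) \<in> (adj E)\<^sup>*"
  shows "\<exists>p. p \<noteq> [] \<and> distinct p \<and> hd p = u \<and> last p = v \<and> successively (\<lambda>a b. {a, b} \<in> E) p"
  using assms
proof (induction rule: rtrancl_induct)
  case base
  then show ?case by (intro exI[of _ "[u]"]) simp
next
  case (step y z)
  then obtain p where p: "p \<noteq> []" "distinct p" "hd p = u" "last p = y"
    "successively (\<lambda>a b. {a, b} \<in> E) p" by auto
  show ?case
  proof (cases "z \<in> set p")
    case True
    then obtain xs ys where "p = xs @ z # ys" by (auto simp: in_set_conv_decomp)
    then show ?thesis using p
      by (intro exI[of _ "xs @ [z]"]) (auto simp: successively_append_iff hd_append)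
  next
    case False
    then show ?thesis using p step.hyps
      by (intro exI[of _ "p @ [z]"]) (auto simp: successively_append_iff)
  qed
qed

text \<open>A path from \<open>u\<close> to \<open>v\<close> that avoids the edge is closed up by
  it. The path has at least three vertices, since with two it would be the avoided edge
  itself.\<close>

lemma nonbridge_on_cycle:
  assumes G: "simple_graph (V, E)" and e: "{u, v} \<in> E"
    and con: "(u, v) \<in> (adj (E - {{u, v}}))\<^sup>*"
  obtains c where "is_cycle (V, E) c" "{u, v} \<in> cycle_edges c"
proof -
  obtain p where p: "p \<noteq> []" "distinct p" "hd p = u" "last p = v"
    "successively (\<lambda>a b. {a, b} \<in> E - {{u, v}}) p"
    using rtrancl_adj_path[OF con] by blast
  have uv: "u \<noteq> v" using simple_graph_edgeD[OF G] e by simp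
  have len: "3 \<le> length p"
  proof (rule ccontr)
    assume "\<not> 3 \<le> length p"
    moreover have "length p \<noteq> 0" using p(1) by simp
    ultimately have "length p = 1 \<or> length p = 2" by linarith
    then show False
      using p uv by (auto simp: length_Suc_conv numeral_2_eq_2)
  qed
  have succ: "successively (\<lambda>a b. {a, b} \<in> E) p"
    using p(5) by (rule successively_mono) auto
  have "set p \<subseteq> V"
  proof
    fix x assume "x \<in> set p"
    then obtain i where i: "i < length p" "x = p ! i" by (auto simp: in_set_conv_nth)
    have "\<exists>j. Suc j < length p \<and> (i = j \<or> i = Suc j)"
      using i len by (cases i) (auto intro: exI[of _ "i - 1"])
    then obtain j where "Suc j < length p" "i = j \<or> i = Suc j" by auto
    then have "{p ! j, p ! Suc j} \<in> E" "x = p ! j \<or> x = p ! Suc j"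
      using succ i by (auto simp: successively_conv_nth)
    then show "x \<in> V" using simple_graph_edgeD[OF G] by auto
  qed
  moreover have "{last p, hd p} \<in> E" using p e by (simp add: insert_commute)
  ultimately show ?thesis
    using that is_cycleI_path[OF p(2) len _ succ] p by (auto simp: insert_commute)
qed

text \<open>The first vertex of a longest path will do: by maximality its neighbours all lie on the
  path, and a neighbour beyond the second vertex would close an initial segment to a cycle.\<close>

lemma acyclic_has_low_degree_vertex:
  assumes G: "simple_graph (V, E)" and "V \<noteq> {}" and acyc: "\<And>c. \<not> is_cycle (V, E) c"
  obtains u where "u \<in> V" "\<And>a b. {u, a} \<in> E \<Longrightarrow> {u, b} \<in> E \<Longrightarrow> a = b"
proof -
  let ?P = "{p. p \<noteq> [] \<and> distinct p \<and> set p \<subseteq> V \<and> successively (\<lambda>a b. {a, b} \<in> E) p}"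
  have "finite V" using G by (simp add: simple_graph_def)
  then have "finite ?P"
    by (intro finite_subset[of ?P "{xs. set xs \<subseteq> V \<and> distinct xs}"] finite_subset_distinct) auto
  moreover obtain x where "x \<in> V" using assms(2) by auto
  moreover from this have "[x] \<in> ?P" by simp
  ultimately have fin: "finite (length ` ?P)" "length ` ?P \<noteq> {}" by blast+
  then have "Max (length ` ?P) \<in> length ` ?P" by (rule Max_in)
  then obtain p where p: "p \<in> ?P" and len: "length p = Max (length ` ?P)" by auto
  have mx: "length p' \<le> length p" if "p' \<in> ?P" for p'
    using that fin(1) unfolding len by (intro Max_ge) auto
  let ?u = "hd p"
  have pne: "p \<noteq> []" using p by simp
  have inp: "a \<in> set p" if "{?u, a} \<in> E" for a
  proof (rule ccontr)
    assume "a \<notin> set p"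
    then have "a # p \<in> ?P"
      using p that simple_graph_edgeD[OF G] by (auto simp: successively_Cons insert_commute)
    then show False using mx by fastforce
  qed
  have second: "a = p ! 1" if a: "{?u, a} \<in> E" for a
  proof (rule ccontr)
    assume a1: "a \<noteq> p ! 1"
    obtain j where j: "j < length p" "a = p ! j" using inp[OF a] by (auto simp: in_set_conv_nth)
    have "j \<noteq> 0" using j pne simple_graph_edgeD(1)[OF G, of ?u a] a by (metis hd_conv_nth snd_conv)
    moreover have "j \<noteq> 1" using a1 j by metis
    ultimately have j2: "2 \<le> j" by linarith
    let ?c = "take (Suc j) p"
    have c: "distinct ?c" "3 \<le> length ?c" "set ?c \<subseteq> V" "successively (\<lambda>a b. {a, b} \<in> E) ?c"
      using p j j2 by (auto dest: in_set_takeD simp: successively_conv_nth)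
    have "last ?c = a" "hd ?c = ?u" using j pne by (auto simp: take_Suc_conv_app_nth hd_append hd_conv_nth)
    then show False using is_cycleI_path(1)[OF c] a acyc by (auto simp: insert_commute)
  qed
  show ?thesis
  proof (rule that[of ?u])
    show "?u \<in> V" using p by auto
  qed (use second in metis)
qed

section \<open>Induced subgraphs\<close>

lemma fst_induced_subgraph [simp]: "fst (induced_subgraph G W) = W"
  by (simp add: induced_subgraph_def)

lemma induced_induced_subgraph:
  "W' \<subseteq> W \<Longrightarrow> induced_subgraph (induced_subgraph G W) W' = induced_subgraph G W'"
  by (auto simp: induced_subgraph_def)

lemma induced_edge_iff: "{u, v} \<in> snd (induced_subgraph G W) \<longleftrightarrow> {u, v} \<in> snd G \<and> u \<in> W \<and> v \<in> W"
  by (auto simp: induced_subgraph_def)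

lemma simple_graph_induced:
  "simple_graph G \<Longrightarrow> W \<subseteq> fst G \<Longrightarrow> simple_graph (induced_subgraph G W)"
  by (auto simp: simple_graph_def induced_subgraph_def intro: finite_subset)

lemma is_cycle_induced_iff:
  assumes "W \<subseteq> fst G"
  shows "is_cycle (induced_subgraph G W) c \<longleftrightarrow> is_cycle G c \<and> set c \<subseteq> W"
proof -
  have "3 \<le> length c \<Longrightarrow> set c \<subseteq> W \<Longrightarrow> e \<in> cycle_edges c \<Longrightarrow> e \<subseteq> W" for e
    using Union_cycle_edges[of c] by (metis Sup_upper dual_order.trans list.size(3) not_numeral_le_zero)
  then show ?thesis using assms
    by (auto simp: is_cycle_def induced_subgraph_def)
qed

section \<open>Weight matrices of a graph\<close>

text \<open>Adjacency and Hermitian adjacency matrices are treated simultaneously: only the products of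
  opposite entries matter.\<close>

definition weights :: "'v set set \<Rightarrow> 'a::field^'v^'v \<Rightarrow> bool" where
  "weights E M \<longleftrightarrow>
     (\<forall>u v. ({u, v} \<in> E \<longrightarrow> M $ u $ v * M $ v $ u = 1) \<and> ({u, v} \<notin> E \<longrightarrow> M $ u $ v = 0))"

lemma weights_zero: "weights E M \<Longrightarrow> {u, v} \<notin> E \<Longrightarrow> M $ u $ v = 0"
  by (simp add: weights_def)

lemma weights_nonzero: "weights E M \<Longrightarrow> {u, v} \<in> E \<Longrightarrow> M $ u $ v \<noteq> 0"
  by (metis weights_def mult_zero_left zero_neq_one)

lemma weights_inverse: "weights E M \<Longrightarrow> {u, v} \<in> E \<Longrightarrow> M $ v $ u = 1 / M $ u $ v"
  using weights_nonzero[of E M u v] by (simp add: weights_def field_simps)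

section \<open>The kernel of a cycle\<close>

text \<open>With \<open>k\<close> the weights along a cycle, the recurrence is the kernel equation
  at position \<open>Suc i\<close>, solved for the later neighbour.\<close>

fun two_step :: "(nat \<Rightarrow> 'a::field) \<Rightarrow> 'a \<Rightarrow> 'a \<Rightarrow> nat \<Rightarrow> 'a" where
  "two_step k a b 0 = a"
| "two_step k a b (Suc 0) = b"
| "two_step k a b (Suc (Suc i)) = - two_step k a b i / (k i * k (Suc i))"

lemma two_step_iterate:
  fixes g k :: "nat \<Rightarrow> 'a::field"
  assumes "\<And>i. g (Suc (Suc i)) = - g i / (k i * k (Suc i))"
  shows "g (i + 2 * j) = (-1) ^ j * g i / (\<Prod>m<2 * j. k (i + m))"
proof (induction j)
  case (Suc j)
  have "g (i + 2 * Suc j) = g (Suc (Suc (i + 2 * j)))" by simp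
  also have "\<dots> = - g (i + 2 * j) / (k (i + 2 * j) * k (Suc (i + 2 * j)))" by (rule assms)
  finally show ?case by (simp add: Suc)
qed simp

lemma prod_shift_periodic:
  fixes k :: "nat \<Rightarrow> 'a::field"
  assumes "\<And>i. k (i + l) = k i" "\<And>i. k i \<noteq> 0"
  shows "(\<Prod>m<l. k (i + m)) = (\<Prod>m<l. k m)"
proof (induction i)
  case (Suc i)
  have "k i * (\<Prod>m<l. k (Suc i + m)) = (\<Prod>m<Suc l. k (i + m))"
    by (subst prod.lessThan_Suc_shift) simp
  also have "\<dots> = k i * (\<Prod>m<l. k (i + m))" using assms(1)[of i] by simp
  finally show ?case using Suc assms(2)[of i] by simp
qed simp

text \<open>The gain of the closed walk \<open>c\<close> in the sense of gain graphs. For a matrix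
  satisfying \<open>weights\<close> on the edges of the cycle, reversing the traversal inverts it,
  so that being 1 or -1 does not depend on the direction.\<close>

definition holonomy :: "'a::field^'v^'v \<Rightarrow> 'v list \<Rightarrow> 'a" where
  "holonomy M c = (\<Prod>i<length c. M $ (c ! i) $ next_vertex c i)"

text \<open>Without chords, the principal submatrix on \<open>set c\<close> is that of the cycle
  alone, and each kernel equation has only two terms.\<close>

locale weighted_cycle =
  fixes E :: "'v::finite set set" and M :: "'a::field^'v^'v" and c :: "'v list"
  assumes M: "weights E M" and dist: "distinct c" and len: "3 \<le> length c"
    and edges: "cycle_edges c \<subseteq> E"
    and chordless: "\<And>u v. u \<in> set c \<Longrightarrow> v \<in> set c \<Longrightarrow> {u, v} \<in> E \<Longrightarrow> {u, v} \<in> cycle_edges c"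
begin

abbreviation k :: "nat \<Rightarrow> 'a" where "k i \<equiv> M $ vtx c i $ vtx c (Suc i)"

lemma nonempty: "c \<noteq> []" using len by auto

lemma edge: "{vtx c i, vtx c (Suc i)} \<in> E"
  using edges nonempty by (auto simp: cycle_edges_eq_range)

lemma k_nonzero: "k i \<noteq> 0"
  using weights_nonzero[OF M edge] .

lemma k_periodic: "k (i + length c) = k i"
  using vtx_add_length(1)[of c "Suc i"] by simp

text \<open>The row is taken at \<open>Suc i\<close> so that its predecessor is \<open>i\<close> and
  no index is subtracted. The two neighbours are distinct because the length exceeds 2.\<close>

lemma mult_vec_cycle:
  assumes supp: "\<And>v. v \<notin> set c \<Longrightarrow> q $ v = 0"
  shows "(M *v q) $ vtx c (Suc i) = k (Suc i) * q $ vtx c (Suc (Suc i)) + q $ vtx c i / k i"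
proof -
  let ?a = "vtx c i" and ?u = "vtx c (Suc i)" and ?b = "vtx c (Suc (Suc i))"
  have "i mod length c \<noteq> Suc (Suc i) mod length c"
  proof
    assume "i mod length c = Suc (Suc i) mod length c"
    then have "length c dvd Suc (Suc i) - i" by (metis le_add2 mod_eq_dvd_iff_nat plus_1_eq_Suc le_SucI)
    then have "length c dvd 2" by simp
    then show False using len by (auto dest: dvd_imp_le)
  qed
  then have ab: "?a \<noteq> ?b" using vtx_eq_iff[OF dist nonempty] by simp
  have "M $ ?u $ w * q $ w = 0" if w: "w \<noteq> ?a" "w \<noteq> ?b" for w
  proof (rule ccontr)
    assume nz: "M $ ?u $ w * q $ w \<noteq> 0"
    then have "w \<in> set c" "{?u, w} \<in> E" using supp weights_zero[OF M] by fastforce+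
    then have "{?u, w} \<in> cycle_edges c" using chordless vtx_in_set[OF nonempty] by blast
    then obtain j where j: "{?u, w} = {vtx c j, vtx c (Suc j)}"
      using nonempty by (auto simp: cycle_edges_eq_range)
    then consider "?u = vtx c j" "w = vtx c (Suc j)" | "?u = vtx c (Suc j)" "w = vtx c j"
      by (auto simp: doubleton_eq_iff)
    then show False
    proof cases
      case 1
      then have "Suc i mod length c = j mod length c" using vtx_eq_iff[OF dist nonempty] by simp
      then have "vtx c (Suc j) = ?b" by (metis vtx_Suc_mod)
      then show False using w 1 by simp
    next
      case 2
      then have "Suc i mod length c = Suc j mod length c" using vtx_eq_iff[OF dist nonempty] by simp
      then have "vtx c j = ?a"
        by (metis Suc_inject mod_Suc vtx_def nat.distinct(1))
      then show False using w 2 by simp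
    qed
  qed
  then have "(\<Sum>w\<in>UNIV. M $ ?u $ w * q $ w) = (\<Sum>w\<in>{?a, ?b}. M $ ?u $ w * q $ w)"
    by (intro sum.mono_neutral_right) auto
  also have "\<dots> = M $ ?u $ ?a * q $ ?a + k (Suc i) * q $ ?b" using ab by simp
  finally show ?thesis
    using weights_inverse[OF M edge, of i] by (simp add: matrix_vector_mult_def)
qed

lemma kernel_cycle_iff:
  "q \<in> kernel_on M (set c) \<longleftrightarrow> (\<forall>v. v \<notin> set c \<longrightarrow> q $ v = 0) \<and>
     (\<forall>i. q $ vtx c (Suc (Suc i)) = - q $ vtx c i / (k i * k (Suc i)))"
proof (cases "\<forall>v. v \<notin> set c \<longrightarrow> q $ v = 0")
  case True
  have "(\<forall>v\<in>set c. (M *v q) $ v = 0) \<longleftrightarrow> (\<forall>i. (M *v q) $ vtx c (Suc i) = 0)"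
  proof (intro iffI ballI allI)
    fix v assume H: "\<forall>i. (M *v q) $ vtx c (Suc i) = 0" and "v \<in> set c"
    then obtain j where j: "v = vtx c j" using in_set_vtx by metis
    have "Suc (j + length c - 1) = j + length c" using len by simp
    then have "v = vtx c (Suc (j + length c - 1))" using j by simp
    then show "(M *v q) $ v = 0" using H by metis
  qed (use vtx_in_set[OF nonempty] in auto)
  also have "\<dots> \<longleftrightarrow> (\<forall>i. q $ vtx c (Suc (Suc i)) = - q $ vtx c i / (k i * k (Suc i)))"
  proof (intro all_cong1)
    fix i
    have "(M *v q) $ vtx c (Suc i) = k (Suc i) * q $ vtx c (Suc (Suc i)) + q $ vtx c i / k i"
      using True by (intro mult_vec_cycle) auto
    then show "(M *v q) $ vtx c (Suc i) = 0 \<longleftrightarrow>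
        q $ vtx c (Suc (Suc i)) = - q $ vtx c i / (k i * k (Suc i))"
      using k_nonzero[of i] k_nonzero[of "Suc i"] by (auto simp: field_simps add_eq_0_iff)
  qed
  finally show ?thesis using True by (simp add: kernel_on_def)
qed (auto simp: kernel_on_def)

lemma kernel_cycle_zero:
  assumes q: "q \<in> kernel_on M (set c)" and "q $ vtx c 0 = 0" "q $ vtx c 1 = 0"
  shows "q = 0"
proof -
  have "q $ vtx c i = 0 \<and> q $ vtx c (Suc i) = 0" for i
    using assms unfolding kernel_cycle_iff by (induction i) auto
  moreover have "q $ v = 0" if "v \<notin> set c" for v using q that by (simp add: kernel_on_def)
  ultimately show ?thesis using in_set_vtx unfolding vec_eq_iff by (metis zero_index)
qed

lemma nullity_cycle_le: "nullity_on M (set c) \<le> 2"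
proof -
  let ?K = "kernel_on M (set c)"
  have "nullity_on M (set c) \<le> vec.dim (?K \<inter> {q. q $ vtx c 0 = 0}) + 1"
    unfolding nullity_on_def by (rule dim_functional_kernel_le[OF subspace_kernel_on]) simp_all
  also have "vec.dim (?K \<inter> {q. q $ vtx c 0 = 0})
      \<le> vec.dim (?K \<inter> {q. q $ vtx c 0 = 0} \<inter> {q. q $ vtx c 1 = 0}) + 1"
    using subspace_kernel_on[of M "set c"]
    by (intro dim_functional_kernel_le) (auto simp: vec.subspace_def)
  also have "vec.dim (?K \<inter> {q. q $ vtx c 0 = 0} \<inter> {q. q $ vtx c 1 = 0}) = 0"
    using kernel_cycle_zero by (subst vec.dim_eq_0) blast
  finally show ?thesis by simp
qed

text \<open>Nullity 2 leaves a nonzero kernel vector that vanishes at position 0. If the length is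
  \<open>2 * m + 1\<close>, then \<open>m + 1\<close> double steps lead from position 0 to position
  1, so it vanishes there too and hence everywhere.\<close>

lemma nullity_cycle_2_even:
  assumes "2 \<le> nullity_on M (set c)"
  shows "even (length c)"
proof (rule ccontr)
  assume odd: "odd (length c)"
  let ?K = "kernel_on M (set c)"
  have "nullity_on M (set c) \<le> vec.dim (?K \<inter> {q. q $ vtx c 0 = 0}) + 1"
    unfolding nullity_on_def by (rule dim_functional_kernel_le[OF subspace_kernel_on]) simp_all
  then have "vec.dim (?K \<inter> {q. q $ vtx c 0 = 0}) \<noteq> 0" using assms by linarith
  then obtain q where q: "q \<in> ?K" "q $ vtx c 0 = 0" "q \<noteq> 0" by (auto simp: vec.dim_eq_0)
  obtain m where m: "length c = 2 * m + 1" using odd by (auto elim: oddE)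
  have "q $ vtx c (0 + 2 * (m + 1)) = (-1) ^ (m + 1) * q $ vtx c 0 / (\<Prod>j<2 * (m + 1). k (0 + j))"
    using q(1) unfolding kernel_cycle_iff by (intro two_step_iterate) auto
  then have "q $ vtx c (0 + 2 * (m + 1)) = 0" using q(2) by simp
  moreover have "0 + 2 * (m + 1) = 1 + length c" using m by simp
  ultimately have "q $ vtx c 1 = 0" by (metis vtx_add_length(1))
  then show False using kernel_cycle_zero q by blast
qed

lemma k_prod: "(\<Prod>m<length c. k (i + m)) = holonomy M c"
proof -
  have "(\<Prod>m<length c. k (i + m)) = (\<Prod>m<length c. k m)"
    by (rule prod_shift_periodic) (fact k_periodic k_nonzero)+
  then show ?thesis by (simp add: holonomy_def next_vertex_eq_vtx vtx_nth)
qed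

text \<open>For even length, \<open>length c div 2\<close> double steps return to the starting
  vertex and multiply the value by \<open>(-1) ^ (length c div 2)\<close> divided by the holonomy;
  starting at a nonzero value, this factor must be 1.\<close>

lemma nullity_cycle_holonomy:
  assumes "even (length c)" "nullity_on M (set c) \<noteq> 0"
  shows "holonomy M c = (-1) ^ (length c div 2)"
proof -
  obtain q where q: "q \<in> kernel_on M (set c)" "q \<noteq> 0"
    using assms(2) by (auto simp: nullity_on_def vec.dim_eq_0)
  then obtain v where "q $ v \<noteq> 0" by (auto simp: vec_eq_iff)
  then obtain s where s: "q $ vtx c s \<noteq> 0" using q(1) in_set_vtx by (metis kernel_cycle_iff)
  have "q $ vtx c (s + 2 * (length c div 2))
      = (-1) ^ (length c div 2) * q $ vtx c s / (\<Prod>m<2 * (length c div 2). k (s + m))"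
    using q(1) unfolding kernel_cycle_iff by (intro two_step_iterate) auto
  moreover have "2 * (length c div 2) = length c" using assms(1) by simp
  ultimately have "q $ vtx c s = (-1) ^ (length c div 2) * q $ vtx c s / holonomy M c"
    by (simp add: k_prod)
  moreover have "holonomy M c \<noteq> 0"
    using k_prod[of 0] k_nonzero by (metis (no_types, lifting) finite_lessThan prod_zero_iff)
  ultimately show ?thesis using s by (simp add: field_simps)
qed

lemma kernel_cycle_exists:
  assumes even: "even (length c)" and hol: "holonomy M c = (-1) ^ (length c div 2)"
  obtains q where "q \<in> kernel_on M (set c)" "\<And>i. q $ vtx c i = two_step k a b i"
proof -
  let ?f = "two_step k a b"
  have len2: "2 * (length c div 2) = length c" using even by simp
  have per: "?f (i + length c) = ?f i" for i
  proof -
    have "?f (i + 2 * (length c div 2))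
        = (-1) ^ (length c div 2) * ?f i / (\<Prod>m<2 * (length c div 2). k (i + m))"
      by (rule two_step_iterate) simp
    then show ?thesis using len2 hol k_prod[of i] by simp
  qed
  have per_mod: "?f i = ?f (i mod length c)" for i
  proof -
    have "?f (r + n * length c) = ?f r" for r n
    proof (induction n)
      case (Suc n)
      have "r + Suc n * length c = (r + n * length c) + length c" by simp
      then show ?case using per[of "r + n * length c"] Suc by metis
    qed simp
    from this[of "i mod length c" "i div length c"] show ?thesis by simp
  qed
  \<comment> \<open>The sequence is periodic, so any index of a vertex gives the same value and the
    choice by \<open>SOME\<close> is harmless.\<close>
  define q :: "'a^'v" where
    "q = (\<chi> v. if v \<in> set c then ?f (SOME i. vtx c i = v) else 0)"
  have qf: "q $ vtx c i = ?f i" for i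
  proof -
    have "vtx c (SOME j. vtx c j = vtx c i) = vtx c i" by (rule someI) simp
    then have "(SOME j. vtx c j = vtx c i) mod length c = i mod length c"
      using vtx_eq_iff[OF dist nonempty] by simp
    then have "?f (SOME j. vtx c j = vtx c i) = ?f i" by (metis per_mod)
    then show ?thesis using vtx_in_set[OF nonempty] by (simp add: q_def)
  qed
  moreover have "q \<in> kernel_on M (set c)"
    unfolding kernel_cycle_iff qf by (auto simp: q_def)
  ultimately show ?thesis using that by blast
qed

text \<open>The recurrence only negates and divides by nonzero weights, so the starting values 1 and
  1 never produce a zero. Such a vector can later be scaled to cancel any defect at a neighbour of
  the cycle.\<close>

lemma kernel_cycle_nowhere_zero:
  assumes "even (length c)" "holonomy M c = (-1) ^ (length c div 2)"
  obtains q where "q \<in> kernel_on M (set c)" "\<And>v. v \<in> set c \<Longrightarrow> q $ v \<noteq> 0"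
proof -
  obtain q where q: "q \<in> kernel_on M (set c)" "\<And>i. q $ vtx c i = two_step k 1 1 i"
    using kernel_cycle_exists[OF assms] by blast
  have "two_step k 1 1 i \<noteq> 0 \<and> two_step k 1 1 (Suc i) \<noteq> 0" for i
    using k_nonzero by (induction i) auto
  then show ?thesis using that q in_set_vtx by metis
qed

lemma nullity_cycle_eq_2:
  assumes "even (length c)" "holonomy M c = (-1) ^ (length c div 2)"
  shows "nullity_on M (set c) = 2"
proof -
  let ?K = "kernel_on M (set c)"
  obtain q where q: "q \<in> ?K" "\<And>i. q $ vtx c i = two_step k 1 0 i"
    using kernel_cycle_exists[OF assms] by blast
  obtain r where r: "r \<in> ?K" "\<And>i. r $ vtx c i = two_step k 0 1 i"
    using kernel_cycle_exists[OF assms] by blast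
  have "nullity_on M (set c) = vec.dim (?K \<inter> {q. q $ vtx c 0 = 0}) + 1"
    unfolding nullity_on_def
    by (rule dim_functional_kernel[OF subspace_kernel_on _ _ q(1)]) (simp_all add: q(2))
  moreover have "r $ vtx c 0 = 0" "r $ vtx c (Suc 0) \<noteq> 0" by (simp_all only: r(2)) simp_all
  then have "vec.dim (?K \<inter> {q. q $ vtx c 0 = 0}) \<noteq> 0"
    using r(1) unfolding vec.dim_eq_0 by force
  ultimately show ?thesis using nullity_cycle_le by linarith
qed

end

section \<open>Pendant vertices\<close>

lemma pendant_unique_neighbour:
  assumes "pendant G u" "{u, v} \<in> snd G" "{u, w} \<in> snd G"
  shows "w = v"
proof -
  have "card {e \<in> snd G. u \<in> e} = 1" using assms(1) by (simp add: pendant_def degree_def)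
  then obtain e where e: "{e \<in> snd G. u \<in> e} = {e}" by (rule card_1_singletonE)
  have "{u, v} \<in> {e \<in> snd G. u \<in> e}" "{u, w} \<in> {e \<in> snd G. u \<in> e}" using assms by simp_all
  then have "{u, v} = {u, w}" unfolding e by simp
  then show ?thesis by (simp add: doubleton_eq_iff) blast
qed

lemma pendantI:
  assumes "simple_graph G" "{u, v} \<in> snd G" "\<And>w. {u, w} \<in> snd G \<Longrightarrow> w = v"
  shows "pendant G u"
proof -
  have "{e \<in> snd G. u \<in> e} = {{u, v}}"
  proof -
    have "e = {u, v}" if e: "e \<in> snd G" "u \<in> e" for e
    proof -
      obtain x y where "e = {x, y}" using simple_graph_edgeE[OF assms(1) e(1)] by blast
      then obtain w where "e = {u, w}" using e(2) by auto
      then show ?thesis using assms(3)[of w] e(1) by simp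
    qed
    moreover have "{u, v} \<in> {e \<in> snd G. u \<in> e}" using assms(2) by simp
    ultimately show ?thesis by blast
  qed
  then show ?thesis using simple_graph_edgeD(2)[OF assms(1,2)] by (simp add: pendant_def degree_def)
qed

section \<open>Extremal vertex sets\<close>

lemma nullity_on_delta:
  assumes G: "simple_graph G" and L: "weights (snd G) L"
    and u: "pendant (induced_subgraph G W) u" and uv: "{u, v} \<in> snd (induced_subgraph G W)"
  shows "nullity_on L W = nullity_on L (W - {u, v})"
proof -
  have e: "{u, v} \<in> snd G" "u \<in> W" "v \<in> W" using uv by (auto simp: induced_edge_iff)
  have no: "{u, w} \<notin> snd G" if "w \<in> W" "w \<noteq> v" for w
    using pendant_unique_neighbour[OF u uv, of w] that e by (auto simp: induced_edge_iff)
  show ?thesis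
  proof (rule nullity_on_pendant)
    show "u \<noteq> v" using simple_graph_edgeD[OF G e(1)] by simp
    show "L $ w $ u = 0" "L $ u $ w = 0" if "w \<in> W" "w \<noteq> v" for w
      using no[OF that] weights_zero[OF L] by (simp_all add: insert_commute)
    show "L $ u $ v \<noteq> 0" "L $ v $ u \<noteq> 0"
      using weights_nonzero[OF L] e(1) by (simp_all add: insert_commute)
  qed (use e in auto)
qed

text \<open>The two matrices may live over different fields, like the complex Hermitian and the real
  adjacency matrix; what they share is the graph of their nonzero entries.\<close>

locale weighted_pair =
  fixes G :: "'v::finite graph" and M :: "'a::field^'v^'v" and N :: "'b::field^'v^'v"
  assumes simple: "simple_graph G" and univ: "fst G = UNIV"
    and M: "weights (snd G) M" and N: "weights (snd G) N"
begin

abbreviation sub :: "'v set \<Rightarrow> 'v graph" where "sub W \<equiv> induced_subgraph G W"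

definition d :: "'v set \<Rightarrow> int" where "d W = cyclomatic_number (sub W)"

text \<open>For \<open>W = UNIV\<close> this is the negative of the rank difference in the
  theorem.\<close>

definition excess :: "'v set \<Rightarrow> int" where
  "excess W = int (nullity_on M W) - int (nullity_on N W)"

definition extremal :: "'v set \<Rightarrow> bool" where "extremal W \<longleftrightarrow> excess W = 2 * d W"

lemma simple_sub: "simple_graph (sub W)"
  using simple_graph_induced[OF simple] univ by simp

lemma is_cycle_sub: "is_cycle (sub W) c \<longleftrightarrow> is_cycle G c \<and> set c \<subseteq> W"
  using is_cycle_induced_iff[of W G c] univ by simp

lemma edge_sub: "{u, v} \<in> snd (sub W) \<longleftrightarrow> {u, v} \<in> snd G \<and> u \<in> W \<and> v \<in> W"
  by (rule induced_edge_iff)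

lemma edge_neq: "{u, v} \<in> snd G \<Longrightarrow> u \<noteq> v"
  using simple_graph_edgeD(1)[OF simple] .

lemma sub_pair: "(W, snd (sub W)) = sub W"
  by (simp add: induced_subgraph_def)

lemma sub_sub: "W' \<subseteq> W \<Longrightarrow> induced_subgraph (sub W) W' = sub W'"
  by (rule induced_induced_subgraph)

lemma d_nonneg: "0 \<le> d W"
  unfolding d_def by (rule cyclomatic_number_nonneg[OF simple_sub])

lemma d_delete_le:
  assumes "x \<in> W" shows "d (W - {x}) \<le> d W"
  using cyclomatic_number_delete_vertex_le[of W "snd (sub W)" x "{}"] simple_sub[of W] assms
  by (simp add: d_def sub_pair sub_sub)

lemma d_delete_cycle_vertex:
  assumes "is_cycle (sub W) c" "x \<in> set c" shows "d (W - {x}) \<le> d W - 1"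
  using cyclomatic_number_delete_cycle_vertex[of W "snd (sub W)" c x] simple_sub[of W] assms
  by (simp add: d_def sub_pair sub_sub)

text \<open>The constant 2 is the worst case in which deleting \<open>x\<close> lowers the nullity
  of \<open>M\<close> by one and raises that of \<open>N\<close> by one.\<close>

lemma excess_delete_le: "x \<in> W \<Longrightarrow> excess W \<le> excess (W - {x}) + 2"
  using nullity_on_le_delete[of x W M] nullity_on_delete_le[of x W N] by (simp add: excess_def)

lemma excess_delta:
  assumes "pendant (sub W) u" "{u, v} \<in> snd (sub W)"
  shows "excess (W - {u, v}) = excess W"
  using nullity_on_delta[OF simple M assms] nullity_on_delta[OF simple N assms]
  by (simp add: excess_def)

lemma nullity_on_isolated_vertex:
  assumes "x \<in> W" "\<And>v. v \<in> W \<Longrightarrow> {x, v} \<notin> snd G" "weights (snd G) L"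
  shows "nullity_on L W = nullity_on L (W - {x}) + 1"
  using assms by (intro nullity_on_isolated weights_zero[OF assms(3)]) (auto simp: insert_commute)

text \<open>A forest can be dismantled by deleting isolated vertices, which lowers both nullities by
  one, and by \<open>\<delta>\<close>-transformations, which change neither.\<close>

lemma excess_acyclic:
  "(\<And>c. \<not> is_cycle (sub W) c) \<Longrightarrow> excess W = 0"
proof (induction "card W" arbitrary: W rule: less_induct)
  case less
  show ?case
  proof (cases "W = {}")
    case True
    then show ?thesis by (simp add: excess_def)
  next
    case False
    have "\<not> is_cycle (W, snd (sub W)) c" for c using less.prems by (simp add: sub_pair)
    then obtain u where u: "u \<in> W" "\<And>a b. {u, a} \<in> snd (sub W) \<Longrightarrow> {u, b} \<in> snd (sub W) \<Longrightarrow> a = b"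
      using acyclic_has_low_degree_vertex[of W "snd (sub W)"] simple_sub False
      by (metis sub_pair)
    have IH: "excess W' = 0" if "W' \<subset> W" for W'
    proof (rule less.hyps)
      show "card W' < card W" using that by (simp add: psubset_card_mono)
      show "\<not> is_cycle (sub W') c" for c using less.prems[of c] that by (auto simp: is_cycle_sub)
    qed
    show ?thesis
    proof (cases "\<exists>v. {u, v} \<in> snd (sub W)")
      case True
      then obtain v where v: "{u, v} \<in> snd (sub W)" by auto
      then have "pendant (sub W) u" using u(2) by (intro pendantI[OF simple_sub]) auto
      then have "excess (W - {u, v}) = excess W" using excess_delta v by blast
      moreover have "excess (W - {u, v}) = 0" using u(1) by (intro IH) auto
      ultimately show ?thesis by simp
    next
      case False
      then have "{u, v} \<notin> snd G" if "v \<in> W" for v using u(1) that by (auto simp: edge_sub)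
      then have "excess W = excess (W - {u})"
        using nullity_on_isolated_vertex[OF u(1) _ M] nullity_on_isolated_vertex[OF u(1) _ N]
        by (simp add: excess_def)
      moreover have "excess (W - {u}) = 0" using u(1) by (intro IH) auto
      ultimately show ?thesis by simp
    qed
  qed
qed

lemma excess_le: "excess W \<le> 2 * d W"
proof (induction "card W" arbitrary: W rule: less_induct)
  case less
  show ?case
  proof (cases "\<exists>c. is_cycle (sub W) c")
    case True
    then obtain c where c: "is_cycle (sub W) c" by auto
    then obtain x where x: "x \<in> set c" using is_cycle_nonempty by (metis list.set_sel(1))
    then have xW: "x \<in> W" using c by (auto simp: is_cycle_sub)
    then have "card (W - {x}) < card W" by (intro psubset_card_mono) auto
    then have "excess (W - {x}) \<le> 2 * d (W - {x})" by (rule less)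
    then show ?thesis using excess_delete_le[OF xW] d_delete_cycle_vertex[OF c x] by linarith
  next
    case False
    then show ?thesis using excess_acyclic[of W] d_nonneg[of W] by auto
  qed
qed

text \<open>In \<open>excess W \<le> excess (W - {x}) + 2 \<le> 2 * d (W - {x}) + 2 \<le> 2 * d
  W\<close> the two ends agree, so every intermediate estimate is an equality.\<close>

lemma extremal_delete_cycle_vertex:
  assumes ext: "extremal W" and c: "is_cycle (sub W) c" "x \<in> set c"
  shows "extremal (W - {x})" "nullity_on M W = nullity_on M (W - {x}) + 1" "d (W - {x}) = d W - 1"
proof -
  have xW: "x \<in> W" using c by (auto simp: is_cycle_sub)
  note facts = ext[unfolded extremal_def] excess_delete_le[OF xW] d_delete_cycle_vertex[OF c]
    excess_le[of "W - {x}"]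
  show "extremal (W - {x})" "d (W - {x}) = d W - 1" using facts unfolding extremal_def by linarith+
  show "nullity_on M W = nullity_on M (W - {x}) + 1"
    using facts nullity_on_le_delete[OF xW, of M] nullity_on_delete_le[OF xW, of N]
    unfolding excess_def by linarith
qed

lemma extremal_vertex_disjoint:
  assumes "extremal W" shows "vertex_disjoint (cycles (sub W))"
proof (rule ccontr)
  assume "\<not> ?thesis"
  then have "\<not> vertex_disjoint (cycles (W, snd (sub W)))" by (simp add: sub_pair)
  then obtain x c where "is_cycle (sub W) c" "x \<in> set c"
    "cyclomatic_number (induced_subgraph (sub W) (W - {x})) \<le> cyclomatic_number (sub W) - 2"
    using intersecting_cycles_cyclomatic_number[of W "snd (sub W)"] simple_sub by (metis sub_pair)
  then show False using extremal_delete_cycle_vertex(3)[OF assms] by (simp add: sub_sub flip: d_def)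
qed

text \<open>The excess is unchanged and \<open>d\<close> cannot grow, while the bound
  \<open>excess_le\<close> for the smaller set forbids \<open>d\<close> to shrink.\<close>

lemma extremal_delta:
  assumes ext: "extremal W" and uv: "pendant (sub W) u" "{u, v} \<in> snd (sub W)"
  shows "extremal (W - {u, v})" "d (W - {u, v}) = d W"
proof -
  have "u \<in> W" "v \<in> W" "u \<noteq> v" using uv(2) edge_neq by (auto simp: edge_sub)
  then have "d (W - {u} - {v}) \<le> d (W - {u})" "d (W - {u}) \<le> d W" by (intro d_delete_le; simp)+
  moreover have "W - {u} - {v} = W - {u, v}" by auto
  ultimately have "d (W - {u, v}) \<le> d W" by simp
  then show "extremal (W - {u, v})" "d (W - {u, v}) = d W"
    using excess_delta[OF uv] excess_le[of "W - {u, v}"] ext unfolding extremal_def by linarith+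
qed

lemma delta_transformation_sub:
  "delta_transformation (sub W) H \<longleftrightarrow>
     (\<exists>u v. pendant (sub W) u \<and> {u, v} \<in> snd (sub W) \<and> H = sub (W - {u, v}))"
  by (auto simp: delta_transformation.simps sub_sub)

lemma extremal_crucial:
  "extremal W \<Longrightarrow> \<exists>W'\<subseteq>W. crucial_subgraph (sub W) (sub W') \<and> extremal W' \<and> d W' = d W"
proof (induction "card W" arbitrary: W rule: less_induct)
  case less
  show ?case
  proof (cases "\<exists>u. pendant (sub W) u")
    case False
    then show ?thesis using less.prems by (auto simp: crucial_subgraph_def)
  next
    case True
    then obtain u where u: "pendant (sub W) u" by auto
    then have "{e \<in> snd (sub W). u \<in> e} \<noteq> {}" unfolding pendant_def degree_def by (metis card.empty zero_neq_one)
    then obtain e where e: "e \<in> snd (sub W)" "u \<in> e" by blast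
    obtain x y where xy: "e = {x, y}" using simple_graph_edgeE[OF simple_sub e(1)] by blast
    then have "e = {u, if u = x then y else x}" using e(2) by auto
    then obtain v where v: "{u, v} \<in> snd (sub W)" using e(1) by metis
    have "u \<in> W" using v by (simp add: edge_sub)
    then have "card (W - {u, v}) < card W" by (intro psubset_card_mono) auto
    then obtain W' where W': "W' \<subseteq> W - {u, v}" "crucial_subgraph (sub (W - {u, v})) (sub W')"
      "extremal W'" "d W' = d (W - {u, v})"
      using less.hyps extremal_delta[OF less.prems u v] by blast
    moreover have "delta_transformation (sub W) (sub (W - {u, v}))"
      using u v by (auto simp: delta_transformation_sub)
    ultimately have "crucial_subgraph (sub W) (sub W')"
      by (auto simp: crucial_subgraph_def intro: converse_rtranclp_into_rtranclp)
    then show ?thesis using W' extremal_delta[OF less.prems u v] by auto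
  qed
qed

lemma cycles_unique:
  assumes "vertex_disjoint (cycles (sub W))" "is_cycle (sub W) c" "is_cycle (sub W) c'"
    "x \<in> set c" "x \<in> set c'"
  shows "set c = set c'" "cycle_edges c = cycle_edges c'"
proof -
  have "(set c, cycle_edges c) \<in> cycles (sub W)" "(set c', cycle_edges c') \<in> cycles (sub W)"
    using assms by (auto simp: cycles_def)
  moreover have "fst (set c, cycle_edges c) \<inter> fst (set c', cycle_edges c') \<noteq> {}"
    using assms(4,5) by auto
  ultimately have "(set c, cycle_edges c) = (set c', cycle_edges c')"
    using assms(1)[unfolded vertex_disjoint_def, rule_format] by metis
  then show "set c = set c'" "cycle_edges c = cycle_edges c'" by auto
qed

text \<open>The cycle joins the ends of a chord, so a chord is not a bridge and lies on a second
  cycle, which would meet \<open>c\<close>.\<close>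

lemma cycle_chordless:
  assumes disj: "vertex_disjoint (cycles (sub W))" and c: "is_cycle (sub W) c"
    and uv: "u \<in> set c" "v \<in> set c" "{u, v} \<in> snd G"
  shows "{u, v} \<in> cycle_edges c"
proof (rule ccontr)
  assume no: "{u, v} \<notin> cycle_edges c"
  have ne: "c \<noteq> []" and sub: "cycle_edges c \<subseteq> snd (sub W)" "set c \<subseteq> W"
    using c by (auto simp: is_cycle_def)
  have e: "{u, v} \<in> snd (sub W)" using uv sub by (auto simp: edge_sub)
  have "(u, v) \<in> (adj (snd (sub W) - {{u, v}}))\<^sup>*"
    using cycle_vertices_connected[OF ne uv(1,2)] no sub by (elim adj_rtrancl_mono[rotated]) auto
  then obtain c' where c': "is_cycle (sub W) c'" "{u, v} \<in> cycle_edges c'"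
    using nonbridge_on_cycle[of W "snd (sub W)" u v] simple_sub e by (metis sub_pair)
  then have "u \<in> set c'" using cycle_edge_vertices is_cycle_nonempty by metis
  then show False using cycles_unique(2)[OF disj c c'(1) uv(1)] c'(2) no by simp
qed

lemma weighted_cycle_sub:
  assumes "vertex_disjoint (cycles (sub W))" "is_cycle (sub W) c" "weights (snd G) L"
  shows "weighted_cycle (snd G) L c"
proof
  have "is_cycle G c" using assms(2) by (simp add: is_cycle_sub)
  then show "distinct c" "3 \<le> length c" "cycle_edges c \<subseteq> snd G" by (simp_all add: is_cycle_def)
  show "{u, v} \<in> cycle_edges c" if "u \<in> set c" "v \<in> set c" "{u, v} \<in> snd G" for u v
    using cycle_chordless[OF assms(1,2) that] .
  show "weights (snd G) L" by (rule assms(3))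
qed

text \<open>The vertices are deleted one by one. As no cycle contains two of them, a cycle through
  the next vertex is still intact when its turn comes.\<close>

lemma extremal_delete_transversal:
  assumes ext: "extremal W" and X: "\<And>x. x \<in> X \<Longrightarrow> \<exists>c. is_cycle (sub W) c \<and> x \<in> set c"
    and tr: "\<And>c x x'. is_cycle (sub W) c \<Longrightarrow> x \<in> X \<Longrightarrow> x' \<in> X \<Longrightarrow> x \<in> set c \<Longrightarrow> x' \<in> set c \<Longrightarrow> x = x'"
  shows "extremal (W - X)"
proof -
  have "finite X" by simp
  then show ?thesis using X tr
  proof (induction X rule: finite_induct)
    case empty
    then show ?case using ext by simp
  next
    case (insert x X)
    have "extremal (W - X)" by (rule insert.IH) (use insert.prems in blast)+
    moreover obtain c where c: "is_cycle (sub W) c" "x \<in> set c" using insert.prems(1) by blast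
    have "set c \<inter> X = {}" using insert.prems(2)[OF c(1), of x] insert.hyps(2) c(2) by blast
    then have "is_cycle (sub (W - X)) c" using c(1) by (auto simp: is_cycle_sub)
    ultimately have "extremal (W - X - {x})" using extremal_delete_cycle_vertex(1) c(2) by blast
    moreover have "W - X - {x} = W - insert x X" by auto
    ultimately show ?case by simp
  qed
qed

end

section \<open>Cycles of pendant-free extremal sets have no exits\<close>

lemma mult_vec_single:
  fixes L :: "'a::field^'n^'m"
  assumes "\<And>u. u \<noteq> w \<Longrightarrow> q $ u \<noteq> 0 \<Longrightarrow> L $ v $ u = 0"
  shows "(L *v q) $ v = L $ v $ w * q $ w"
proof -
  have "(\<Sum>u\<in>UNIV. L $ v $ u * q $ u) = (\<Sum>u\<in>{w}. L $ v $ u * q $ u)"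
    using assms by (intro sum.mono_neutral_right) auto
  then show ?thesis by (simp add: matrix_vector_mult_def)
qed

context weighted_pair
begin

section \<open>Connected sets and blocks\<close>

definition conn :: "'v set \<Rightarrow> bool" where
  "conn S \<longleftrightarrow> (\<forall>a\<in>S. \<forall>b\<in>S. (a, b) \<in> (adj {e \<in> snd G. e \<subseteq> S})\<^sup>*)"

lemma conn_Un:
  assumes S: "conn S" and B: "conn B" and sb: "s \<in> S" "b \<in> B" "{s, b} \<in> snd G"
  shows "conn (S \<union> B)"
proof -
  let ?R = "(adj {e \<in> snd G. e \<subseteq> S \<union> B})\<^sup>*"
  have SS: "(x, y) \<in> ?R" if "x \<in> S" "y \<in> S" for x y
    by (rule adj_rtrancl_mono[of "{e \<in> snd G. e \<subseteq> S}"]) (use S that in \<open>auto simp: conn_def\<close>)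
  have BB: "(x, y) \<in> ?R" if "x \<in> B" "y \<in> B" for x y
    by (rule adj_rtrancl_mono[of "{e \<in> snd G. e \<subseteq> B}"]) (use B that in \<open>auto simp: conn_def\<close>)
  have sb': "(s, b) \<in> ?R" using sb by (intro r_into_rtrancl) auto
  have to_s: "(x, s) \<in> ?R" if "x \<in> S \<union> B" for x
  proof (cases "x \<in> S")
    case True
    then show ?thesis using SS sb by simp
  next
    case False
    then have "(x, b) \<in> ?R" using that BB sb by simp
    then show ?thesis using adj_rtrancl_sym[OF sb'] by (rule rtrancl_trans)
  qed
  show ?thesis unfolding conn_def
  proof (intro ballI)
    fix x y assume "x \<in> S \<union> B" "y \<in> S \<union> B"
    then show "(x, y) \<in> ?R" by (intro rtrancl_trans[OF to_s adj_rtrancl_sym[OF to_s]])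
  qed
qed

lemma conn_cycle: "is_cycle (sub W) c \<Longrightarrow> conn (set c)"
proof -
  assume c: "is_cycle (sub W) c"
  then have ne: "c \<noteq> []" by (rule is_cycle_nonempty)
  have "cycle_edges c \<subseteq> snd G" using c unfolding is_cycle_sub by (simp add: is_cycle_def)
  then have "cycle_edges c \<subseteq> {e \<in> snd G. e \<subseteq> set c}"
    using Union_cycle_edges[OF ne] by auto
  from adj_rtrancl_mono[OF this] show ?thesis
    unfolding conn_def using cycle_vertices_connected[OF ne] by simp
qed

text \<open>If the cycles are disjoint, then contracting the blocks turns the graph into a forest.\<close>

definition block :: "'v set \<Rightarrow> 'v set \<Rightarrow> bool" where
  "block W B \<longleftrightarrow> (\<exists>c. is_cycle (sub W) c \<and> B = set c) \<or>
     (\<exists>v\<in>W. B = {v} \<and> (\<forall>c. is_cycle (sub W) c \<longrightarrow> v \<notin> set c))"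

lemma block_exists: "v \<in> W \<Longrightarrow> \<exists>B. block W B \<and> v \<in> B"
  unfolding block_def by blast

lemma block_subset: "block W B \<Longrightarrow> B \<subseteq> W"
  by (auto simp: block_def is_cycle_sub)

lemma block_unique:
  assumes "vertex_disjoint (cycles (sub W))" "block W B" "block W B'" "x \<in> B" "x \<in> B'"
  shows "B = B'"
  using assms(2-5) cycles_unique(1)[OF assms(1)] unfolding block_def by (elim disjE exE bexE conjE) auto

lemma block_conn: "block W B \<Longrightarrow> conn B"
  using conn_cycle by (auto simp: block_def conn_def)

text \<open>Connectedness lets two edges to an outside block close up to a cycle; saturation under
  blocks makes the block of an outside vertex disjoint from \<open>S\<close>.\<close>

definition block_closed :: "'v set \<Rightarrow> 'v set \<Rightarrow> bool" where
  "block_closed W S \<longleftrightarrow> S \<subseteq> W \<and> conn S \<and> (\<forall>B. block W B \<longrightarrow> B \<inter> S \<noteq> {} \<longrightarrow> B \<subseteq> S)"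

lemma block_closed_Un:
  assumes disj: "vertex_disjoint (cycles (sub W))" and S: "block_closed W S" and B: "block W B"
    and sb: "s \<in> S" "b \<in> B" "{s, b} \<in> snd G"
  shows "block_closed W (S \<union> B)"
  unfolding block_closed_def
proof (intro conjI allI impI)
  show "S \<union> B \<subseteq> W" using S B block_subset by (auto simp: block_closed_def)
  show "conn (S \<union> B)" using S block_conn[OF B] sb by (auto simp: block_closed_def intro: conn_Un)
  fix B' assume B': "block W B'" "B' \<inter> (S \<union> B) \<noteq> {}"
  then show "B' \<subseteq> S \<union> B"
    using S block_unique[OF disj B'(1) B] unfolding block_closed_def by blast
qed

text \<open>With a second edge one could pass from \<open>b1\<close> through \<open>B\<close> to
  \<open>b2\<close>, over to \<open>s2\<close> and through \<open>S\<close> to \<open>s1\<close>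
  without using \<open>{b1, s1}\<close>. This edge would lie on a cycle, which is then the block
  \<open>B\<close> itself and cannot contain \<open>s1\<close>.\<close>

lemma block_closed_unique_edge:
  assumes disj: "vertex_disjoint (cycles (sub W))" and S: "block_closed W S" and B: "block W B"
    and SB: "B \<inter> S = {}" and e1: "b1 \<in> B" "s1 \<in> S" "{b1, s1} \<in> snd G"
    and e2: "b2 \<in> B" "s2 \<in> S" "{b2, s2} \<in> snd G"
  shows "b1 = b2 \<and> s1 = s2"
proof (rule ccontr)
  assume neq: "\<not> ?thesis"
  let ?E = "snd (sub W) - {{b1, s1}}"
  have BW: "B \<subseteq> W" and SW: "S \<subseteq> W" using block_subset[OF B] S by (auto simp: block_closed_def)
  have "{e \<in> snd G. e \<subseteq> B} \<subseteq> ?E" "{e \<in> snd G. e \<subseteq> S} \<subseteq> ?E"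
    using BW SW SB e1 by (auto simp: induced_subgraph_def)
  moreover have "(b1, b2) \<in> (adj {e \<in> snd G. e \<subseteq> B})\<^sup>*" "(s2, s1) \<in> (adj {e \<in> snd G. e \<subseteq> S})\<^sup>*"
    using block_conn[OF B] S e1 e2 by (simp_all add: conn_def block_closed_def)
  ultimately have bs: "(b1, b2) \<in> (adj ?E)\<^sup>*" "(s2, s1) \<in> (adj ?E)\<^sup>*"
    using adj_rtrancl_mono[of "{e \<in> snd G. e \<subseteq> B}" ?E b1 b2]
      adj_rtrancl_mono[of "{e \<in> snd G. e \<subseteq> S}" ?E s2 s1] by simp_all
  have "{b2, s2} \<noteq> {b1, s1}" using neq SB e1 e2 by (auto simp: doubleton_eq_iff)
  then have step: "(b2, s2) \<in> adj ?E" using e2 BW SW by (auto simp: edge_sub)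
  have "(b1, s1) \<in> (adj ?E)\<^sup>*"
    by (rule rtrancl_trans[OF rtrancl_into_rtrancl[OF bs(1) step] bs(2)])
  moreover have "{b1, s1} \<in> snd (sub W)" using e1 BW SW by (auto simp: edge_sub)
  ultimately obtain c where c: "is_cycle (sub W) c" "{b1, s1} \<in> cycle_edges c"
    using nonbridge_on_cycle[of W "snd (sub W)" b1 s1] simple_sub by (metis sub_pair)
  have mem: "b1 \<in> set c" "s1 \<in> set c" using cycle_edge_vertices[OF is_cycle_nonempty[OF c(1)] c(2)] .
  have "block W (set c)" using c(1) by (auto simp: block_def)
  then have "set c = B" using block_unique[OF disj _ B mem(1) e1(1)] by blast
  then show False using mem(2) e1(2) SB by auto
qed

text \<open>Growing a connected union of blocks, starting from the cycle, one extends a vector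
  satisfying the kernel equations at all vertices of the union except \<open>y\<close>. When an equation fails at a
  vertex outside the union, that vertex is deleted if it lies on a cycle; otherwise it has a further
  neighbour, and a multiple of the kernel vector of the block of this neighbour repairs the equation.
  In the end the equation fails only at \<open>y\<close>, which bounds the nullity in a way that contradicts
  extremality.\<close>

definition partial_kernel ::
    "'v set \<Rightarrow> 'v set \<Rightarrow> 'v \<Rightarrow> 'v set \<Rightarrow> 'v set \<Rightarrow> 'a^'v \<Rightarrow> bool" where
  "partial_kernel W C y S X q \<longleftrightarrow> block_closed W S \<and> C \<subseteq> S \<and> X \<subseteq> S - C \<and>
     (\<forall>x\<in>X. \<exists>c. is_cycle (sub W) c \<and> x \<in> set c) \<and>
     (\<forall>c x x'. is_cycle (sub W) c \<longrightarrow> x \<in> X \<longrightarrow> x' \<in> X \<longrightarrow> x \<in> set c \<longrightarrow> x' \<in> set c \<longrightarrow> x = x') \<and>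
     (\<forall>v. q $ v \<noteq> 0 \<longrightarrow> v \<in> S - X - C) \<and>
     (M *v q) $ y \<noteq> 0 \<and> (\<forall>v\<in>S - X - {y}. (M *v q) $ v = 0)"

lemma partial_kernelD:
  assumes "partial_kernel W C y S X q"
  shows "block_closed W S" "C \<subseteq> S" "X \<subseteq> S - C"
    "\<forall>x\<in>X. \<exists>c. is_cycle (sub W) c \<and> x \<in> set c"
    "\<forall>c x x'. is_cycle (sub W) c \<longrightarrow> x \<in> X \<longrightarrow> x' \<in> X \<longrightarrow> x \<in> set c \<longrightarrow> x' \<in> set c \<longrightarrow> x = x'"
    "\<forall>v. q $ v \<noteq> 0 \<longrightarrow> v \<in> S - X - C"
    "(M *v q) $ y \<noteq> 0" "\<forall>v\<in>S - X - {y}. (M *v q) $ v = 0"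
  using assms unfolding partial_kernel_def by - (elim conjE, assumption)+

lemma partial_kernel_step:
  assumes disj: "vertex_disjoint (cycles (sub W))" and nopend: "\<And>u. \<not> pendant (sub W) u"
    and ker: "\<And>B. block W B \<Longrightarrow> B \<inter> C = {} \<Longrightarrow> \<exists>p\<in>kernel_on M B. \<forall>v\<in>B. p $ v \<noteq> 0"
    and yC: "y \<in> C"
    and pk: "partial_kernel W C y S X q" and v: "v \<in> W" "v \<notin> S" "(M *v q) $ v \<noteq> 0"
  shows "\<exists>S' X' q'. partial_kernel W C y S' X' q' \<and> S \<subset> S'"
proof -
  note cl = partial_kernelD(1)[OF pk] and CS = partial_kernelD(2)[OF pk] and XS = partial_kernelD(3)[OF pk]
    and Xc = partial_kernelD(4)[OF pk, rule_format] and Xu = partial_kernelD(5)[OF pk, rule_format]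
    and supp = partial_kernelD(6)[OF pk, rule_format]
    and qy = partial_kernelD(7)[OF pk] and q0 = partial_kernelD(8)[OF pk, rule_format]
  have SW: "S \<subseteq> W" using cl by (simp add: block_closed_def)
  obtain s where s: "q $ s \<noteq> 0" "M $ v $ s \<noteq> 0"
    using v(3) mult_vec_eq_0 by metis
  have sS: "s \<in> S" using supp s by blast
  have vs: "{v, s} \<in> snd G" using weights_zero[OF M] s(2) by blast
  then have sv: "{s, v} \<in> snd G" by (simp add: insert_commute)
  obtain B where B: "block W B" "v \<in> B" using block_exists v(1) by blast
  have BS: "B \<inter> S = {}" using cl B v(2) unfolding block_closed_def by blast
  have cl1: "block_closed W (S \<union> B)" by (rule block_closed_Un[OF disj cl B(1) sS B(2) sv])
  \<comment> \<open>The edge \<open>{v, s}\<close> is the only one between \<open>B\<close> and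
    \<open>S\<close>, so the equations at the other vertices of \<open>B\<close> do not see
    \<open>q\<close>.\<close>
  have only_v: "(M *v q) $ u = 0" if u: "u \<in> B" "u \<noteq> v" for u
  proof (rule mult_vec_eq_0)
    fix t assume "q $ t \<noteq> 0"
    then have "t \<in> S" using supp by blast
    then have "{u, t} \<notin> snd G"
      using block_closed_unique_edge[OF disj cl B(1) BS B(2) sS vs u(1)] u(2) by blast
    then show "M $ u $ t = 0" by (rule weights_zero[OF M])
  qed
  show ?thesis
  proof (cases "\<exists>c. is_cycle (sub W) c \<and> v \<in> set c")
    case True
    then obtain c where c: "is_cycle (sub W) c" "v \<in> set c" by auto
    then have Bc: "set c = B" using block_unique[OF disj _ B(1) c(2) B(2)] by (auto simp: block_def)
    have "partial_kernel W C y (S \<union> B) (insert v X) q"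
      unfolding partial_kernel_def
    proof (intro conjI)
      show "insert v X \<subseteq> S \<union> B - C" using XS B(2) BS CS by blast
      show "\<forall>x\<in>insert v X. \<exists>c. is_cycle (sub W) c \<and> x \<in> set c" using Xc c by blast
      \<comment> \<open>A cycle through \<open>v\<close> has vertex set \<open>B\<close>, which is
        disjoint from \<open>S\<close>, whereas all earlier deleted vertices lie in
        \<open>S\<close>.\<close>
      have notX: "x \<notin> set c'" if "x \<in> X" "is_cycle (sub W) c'" "v \<in> set c'" for x c'
      proof -
        have "set c' = B" using cycles_unique(1)[OF disj that(2) c(1) that(3) c(2)] Bc by simp
        then show ?thesis using that(1) XS BS by blast
      qed
      show "\<forall>c x x'. is_cycle (sub W) c \<longrightarrow> x \<in> insert v X \<longrightarrow> x' \<in> insert v X \<longrightarrow>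
          x \<in> set c \<longrightarrow> x' \<in> set c \<longrightarrow> x = x'"
        using Xu notX by (metis insert_iff)
      show "\<forall>u. q $ u \<noteq> 0 \<longrightarrow> u \<in> S \<union> B - insert v X - C" using supp v(2) by blast
      show "\<forall>u\<in>S \<union> B - insert v X - {y}. (M *v q) $ u = 0" using q0 only_v by blast
    qed (use cl1 CS qy in auto)
    moreover have "S \<subset> S \<union> B" using B(2) v(2) by blast
    ultimately show ?thesis by blast
  next
    case False
    then have Bv: "B = {v}" using B by (auto simp: block_def)
    have "{v, s} \<in> snd (sub W)" using vs v(1) sS SW by (auto simp: edge_sub)
    \<comment> \<open>If \<open>s\<close> were the only neighbour of \<open>v\<close>, then
      \<open>v\<close> would be pendant.\<close>
    then obtain w where w: "{v, w} \<in> snd (sub W)" "w \<noteq> s"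
      using pendantI[OF simple_sub] nopend by metis
    then have vw: "{v, w} \<in> snd G" "w \<in> W" by (auto simp: edge_sub)
    have wv: "w \<noteq> v" using edge_neq[OF vw(1)] by simp
    have wS: "w \<notin> S"
      using block_closed_unique_edge[OF disj cl B(1) BS B(2) sS vs B(2) _ vw(1)] w(2) by blast
    obtain B' where B': "block W B'" "w \<in> B'" using block_exists vw(2) by blast
    have B'S: "B' \<inter> (S \<union> B) = {}"
      using cl1 B' wS wv Bv unfolding block_closed_def by blast
    have wv': "{w, v} \<in> snd G" using vw(1) by (simp add: insert_commute)
    have unique: "b = w \<and> t = v" if "b \<in> B'" "t \<in> S \<union> B" "{b, t} \<in> snd G" for b t
      using block_closed_unique_edge[OF disj cl1 B'(1) B'S B'(2) _ wv' that] B(2) by blast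
    have B'C: "B' \<inter> C = {}" using B'S CS by blast
    obtain p where p: "p \<in> kernel_on M B'" "\<And>u. u \<in> B' \<Longrightarrow> p $ u \<noteq> 0"
      using ker[OF B'(1) B'C] by blast
    have psupp: "u \<in> B'" if "p $ u \<noteq> 0" for u using p(1) that by (auto simp: kernel_on_def)
    \<comment> \<open>The scalar is chosen to cancel the defect at \<open>v\<close>; it is well
      defined because \<open>p\<close> has no zero on \<open>B'\<close>. As \<open>{w, v}\<close> is
      the only edge from \<open>B'\<close> to \<open>S \<union> B\<close>, nothing else is
      disturbed.\<close>
    define \<alpha> where "\<alpha> = - (M *v q) $ v / (M $ v $ w * p $ w)"
    define q' where "q' = q + \<alpha> *s p"
    have Mq': "(M *v q') $ u = (M *v q) $ u + \<alpha> * (M *v p) $ u" for u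
      by (simp add: q'_def mult_vec_add mult_vec_scale)
    have Mp_S: "(M *v p) $ u = 0" if "u \<in> S" for u
    proof (rule mult_vec_eq_0)
      fix t assume "p $ t \<noteq> 0"
      then have "{t, u} \<notin> snd G" using unique[of t u] psupp that v(2) by blast
      then show "M $ u $ t = 0" using weights_zero[OF M] by (simp add: insert_commute)
    qed
    have Mp_v: "(M *v p) $ v = M $ v $ w * p $ w"
    proof (rule mult_vec_single)
      fix t assume "t \<noteq> w" "p $ t \<noteq> 0"
      then have "{t, v} \<notin> snd G" using unique[of t v] psupp B(2) by blast
      then show "M $ v $ t = 0" using weights_zero[OF M] by (simp add: insert_commute)
    qed
    have Mq_B': "(M *v q) $ u = 0" if "u \<in> B'" for u
    proof (rule mult_vec_eq_0)
      fix t assume "q $ t \<noteq> 0"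
      then have "{u, t} \<notin> snd G" using unique[OF that, of t] supp v(2) by blast
      then show "M $ u $ t = 0" by (rule weights_zero[OF M])
    qed
    have "M $ v $ w * p $ w \<noteq> 0" using weights_nonzero[OF M vw(1)] p(2)[OF B'(2)] by simp
    then have v0: "(M *v q') $ v = 0" unfolding Mq' Mp_v \<alpha>_def by simp
    have "partial_kernel W C y (S \<union> B \<union> B') X q'"
      unfolding partial_kernel_def
    proof (intro conjI)
      show "block_closed W (S \<union> B \<union> B')"
        using block_closed_Un[OF disj cl1 B'(1) _ B'(2) vw(1)] B(2) by blast
      show "\<forall>u. q' $ u \<noteq> 0 \<longrightarrow> u \<in> S \<union> B \<union> B' - X - C"
      proof (intro allI impI)
        fix u assume "q' $ u \<noteq> 0"
        then have "q $ u \<noteq> 0 \<or> p $ u \<noteq> 0" by (auto simp: q'_def)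
        then show "u \<in> S \<union> B \<union> B' - X - C" using supp[of u] psupp[of u] B'S XS CS by blast
      qed
      show "(M *v q') $ y \<noteq> 0" using qy Mq' Mp_S yC CS by auto
      show "\<forall>u\<in>S \<union> B \<union> B' - X - {y}. (M *v q') $ u = 0"
      proof
        fix u assume u: "u \<in> S \<union> B \<union> B' - X - {y}"
        then consider "u \<in> S" | "u = v" | "u \<in> B'" using Bv by blast
        then show "(M *v q') $ u = 0"
        proof cases
          case 1
          then show ?thesis using u q0 Mp_S Mq' by simp
        next
          case 3
          then have "(M *v p) $ u = 0" using p(1) by (simp add: kernel_on_def)
          then show ?thesis using Mq_B'[OF 3] Mq' by simp
        qed (simp add: v0)
      qed
      show "\<forall>x\<in>X. \<exists>c. is_cycle (sub W) c \<and> x \<in> set c" using Xc by blast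
      show "\<forall>c x x'. is_cycle (sub W) c \<longrightarrow> x \<in> X \<longrightarrow> x' \<in> X \<longrightarrow> x \<in> set c \<longrightarrow> x' \<in> set c \<longrightarrow> x = x'"
        using Xu by blast
    qed (use CS XS in auto)
    moreover have "S \<subset> S \<union> B \<union> B'" using B(2) v(2) by blast
    ultimately show ?thesis by blast
  qed
qed

text \<open>The growth stops when no equation outside \<open>S\<close> fails, which may happen
  before \<open>S\<close> exhausts \<open>W\<close>.\<close>

lemma partial_kernel_complete:
  assumes "vertex_disjoint (cycles (sub W))" "\<And>u. \<not> pendant (sub W) u"
    "\<And>B. block W B \<Longrightarrow> B \<inter> C = {} \<Longrightarrow> \<exists>p\<in>kernel_on M B. \<forall>v\<in>B. p $ v \<noteq> 0" "y \<in> C"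
  shows "partial_kernel W C y S X q \<Longrightarrow>
    \<exists>S' X' q'. partial_kernel W C y S' X' q' \<and> (\<forall>v\<in>W - S'. (M *v q') $ v = 0)"
proof (induction "card (- S)" arbitrary: S X q rule: less_induct)
  case less
  show ?case
  proof (cases "\<forall>v\<in>W - S. (M *v q) $ v = 0")
    case True
    then show ?thesis using less.prems by blast
  next
    case False
    then obtain v where "v \<in> W" "v \<notin> S" "(M *v q) $ v \<noteq> 0" by blast
    then obtain S' X' q' where S': "partial_kernel W C y S' X' q'" "S \<subset> S'"
      using partial_kernel_step[OF assms less.prems] by blast
    have "card (- S') < card (- S)" using S'(2) by (intro psubset_card_mono) auto
    then show ?thesis using less.hyps S'(1) by blast
  qed
qed

text \<open>There are no loops, so the 1-by-1 submatrix is zero; single-vertex blocks thus always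
  supply the kernel vector required for the growth.\<close>

lemma kernel_on_singleton:
  assumes "weights (snd G) L"
  shows "\<exists>p\<in>kernel_on L {v}. p $ v \<noteq> 0"
proof
  have "L $ v $ v = 0" using weights_zero[OF assms] edge_neq by blast
  then show "axis v 1 \<in> kernel_on L {v}"
    by (auto simp: kernel_on_def mult_vec_axis axis_1_nth)
  show "axis v 1 $ v \<noteq> (0::'c)" by (simp add: axis_1_nth)
qed

text \<open>Kernel vectors are requested for the cycles other than \<open>c\<close> only: the vector
  to be built vanishes on \<open>c\<close>. The lemma therefore applies to a single remaining cycle
  before anything is known about its weights.\<close>

lemma extremal_cycle_no_exit:
  assumes ext: "extremal W" and nopend: "\<And>u. \<not> pendant (sub W) u" and c: "is_cycle (sub W) c"
    and ker: "\<And>c'. is_cycle (sub W) c' \<Longrightarrow> set c' \<noteq> set c \<Longrightarrow> \<exists>p\<in>kernel_on M (set c'). \<forall>v\<in>set c'. p $ v \<noteq> 0"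
    and y: "y \<in> set c" and z: "z \<in> W" "z \<notin> set c"
  shows "{y, z} \<notin> snd G"
proof
  assume yz: "{y, z} \<in> snd G"
  have disj: "vertex_disjoint (cycles (sub W))" by (rule extremal_vertex_disjoint[OF ext])
  have bc: "block W (set c)" using c by (auto simp: block_def)
  have bker: "\<exists>p\<in>kernel_on M B. \<forall>v\<in>B. p $ v \<noteq> 0" if B: "block W B" "B \<inter> set c = {}" for B
  proof -
    consider c' where "is_cycle (sub W) c'" "B = set c'" | v where "B = {v}"
      using B(1) unfolding block_def by blast
    then show ?thesis
    proof cases
      case 1
      then show ?thesis using ker[OF 1(1)] B(2) y by auto
    next
      case 2
      then show ?thesis using kernel_on_singleton[OF M] by simp
    qed
  qed
  have clc: "block_closed W (set c)"
    unfolding block_closed_def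
    using block_subset[OF bc] block_conn[OF bc] block_unique[OF disj _ bc] by blast
  obtain B where B: "block W B" "z \<in> B" using block_exists z(1) by blast
  have Bc: "B \<inter> set c = {}" using block_unique[OF disj B(1) bc] B(2) z(2) by blast
  obtain p where p: "p \<in> kernel_on M B" "\<And>u. u \<in> B \<Longrightarrow> p $ u \<noteq> 0"
    using bker[OF B(1) Bc] by blast
  have psupp: "u \<in> B" if "p $ u \<noteq> 0" for u using p(1) that by (auto simp: kernel_on_def)
  have zy: "{z, y} \<in> snd G" using yz by (simp add: insert_commute)
  have unique: "b = z \<and> t = y" if "b \<in> B" "t \<in> set c" "{b, t} \<in> snd G" for b t
    using block_closed_unique_edge[OF disj clc B(1) Bc B(2) y zy that] by blast
  \<comment> \<open>Growth starts with \<open>c\<close> and the block of \<open>z\<close>, no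
    deleted vertex, and a kernel vector of that block; the edge \<open>{y, z}\<close> makes the
    equation at \<open>y\<close> fail.\<close>
  have "partial_kernel W (set c) y (set c \<union> B) {} p"
    unfolding partial_kernel_def
  proof (intro conjI)
    show "block_closed W (set c \<union> B)" by (rule block_closed_Un[OF disj clc B(1) y B(2) yz])
    show "\<forall>v. p $ v \<noteq> 0 \<longrightarrow> v \<in> set c \<union> B - {} - set c" using psupp Bc by blast
    have "(M *v p) $ y = M $ y $ z * p $ z"
    proof (rule mult_vec_single)
      fix t assume "t \<noteq> z" "p $ t \<noteq> 0"
      then have "{t, y} \<notin> snd G" using unique[of t y] psupp y by blast
      then show "M $ y $ t = 0" using weights_zero[OF M] by (simp add: insert_commute)
    qed
    then show "(M *v p) $ y \<noteq> 0" using weights_nonzero[OF M yz] p(2)[OF B(2)] by simp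
    show "\<forall>v\<in>set c \<union> B - {} - {y}. (M *v p) $ v = 0"
    proof
      fix v assume v: "v \<in> set c \<union> B - {} - {y}"
      show "(M *v p) $ v = 0"
      proof (cases "v \<in> B")
        case True
        then show ?thesis using p(1) by (simp add: kernel_on_def)
      next
        case False
        show ?thesis
        proof (rule mult_vec_eq_0)
          fix t assume "p $ t \<noteq> 0"
          then have "{t, v} \<notin> snd G" using unique[of t v] psupp v False by blast
          then show "M $ v $ t = 0" using weights_zero[OF M] by (simp add: insert_commute)
        qed
      qed
    qed
  qed auto
  then obtain S X q where pk: "partial_kernel W (set c) y S X q"
    and out: "\<forall>v\<in>W - S. (M *v q) $ v = 0"
    using partial_kernel_complete[OF disj nopend bker y] by blast
  note XS = partial_kernelD(3)[OF pk] and Xc = partial_kernelD(4)[OF pk, rule_format]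
    and Xu = partial_kernelD(5)[OF pk, rule_format] and supp = partial_kernelD(6)[OF pk, rule_format]
    and qy = partial_kernelD(7)[OF pk] and q0 = partial_kernelD(8)[OF pk, rule_format]
  have SW: "S \<subseteq> W" using partial_kernelD(1)[OF pk] by (simp add: block_closed_def)
  \<comment> \<open>After deleting \<open>X\<close> equality persists and \<open>c\<close> is
    intact, so deleting \<open>y\<close> must lower the nullity of \<open>M\<close>; the vector
    \<open>q\<close>, whose only defect is at \<open>y\<close>, shows that it does not.\<close>
  have "extremal (W - X)" by (rule extremal_delete_transversal[OF ext Xc Xu])
  moreover have "is_cycle (sub (W - X)) c" using c XS by (auto simp: is_cycle_sub)
  ultimately have "nullity_on M (W - X) = nullity_on M (W - X - {y}) + 1"
    using extremal_delete_cycle_vertex(2) y by blast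
  moreover have "nullity_on M (W - X) \<le> nullity_on M (W - X - {y})"
  proof (rule nullity_on_delete_ge[OF _ _ qy])
    show "y \<in> W - X" using y c XS by (auto simp: is_cycle_sub)
    show "q \<in> kernel_on M (W - X - {y})"
      unfolding kernel_on_def
    proof (intro CollectI conjI allI impI ballI)
      show "q $ v = 0" if "v \<notin> W - X - {y}" for v using supp[of v] that SW y by blast
      show "(M *v q) $ v = 0" if "v \<in> W - X - {y}" for v
        using q0[of v] out that by blast
    qed
  qed
  ultimately show False by simp
qed

section \<open>The extremal characterization\<close>

lemma nullity_on_delete_component:
  assumes "weights (snd G) L" "S \<subseteq> W" "\<And>y z. y \<in> S \<Longrightarrow> z \<in> W - S \<Longrightarrow> {y, z} \<notin> snd G"
  shows "nullity_on L W = nullity_on L S + nullity_on L (W - S)"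
proof -
  have "nullity_on L (S \<union> (W - S)) = nullity_on L S + nullity_on L (W - S)"
  proof (rule nullity_on_Un)
    show "L $ u $ v = 0 \<and> L $ v $ u = 0" if "u \<in> S" "v \<in> W - S" for u v
      using assms(3)[OF that] weights_zero[OF assms(1)] by (metis insert_commute)
  qed auto
  moreover have "S \<union> (W - S) = W" using assms(2) by auto
  ultimately show ?thesis by simp
qed

text \<open>All other cycles are destroyed by deleting one vertex each; then \<open>c\<close> is reached by
  \<open>\<delta>\<close>-transformations.\<close>

lemma extremal_cycle_nullity:
  assumes ext: "extremal W" and c: "is_cycle (sub W) c"
  shows "nullity_on M (set c) = 2" "nullity_on N (set c) = 0"
proof -
  have disj: "vertex_disjoint (cycles (sub W))" by (rule extremal_vertex_disjoint[OF ext])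
  define other where "other = {set c' |c'. is_cycle (sub W) c' \<and> set c' \<noteq> set c}"
  \<comment> \<open>One vertex is picked from each vertex set of another cycle, not from each list,
    since one cycle has many traversals.\<close>
  define X where "X = (\<lambda>B. SOME x. x \<in> B) ` other"
  have ne: "B \<noteq> {}" if B: "B \<in> other" for B
  proof -
    obtain c' where c': "B = set c'" "is_cycle (sub W) c'" using B unfolding other_def by blast
    then show ?thesis using is_cycle_nonempty[OF c'(2)] by simp
  qed
  have some: "(SOME x. x \<in> B) \<in> B" if "B \<in> other" for B
    using ne[OF that] some_in_eq by blast
  have inB: "B = set c'" if "B \<in> other" "is_cycle (sub W) c'" "x \<in> B" "x \<in> set c'" for B c' x
    using that cycles_unique(1)[OF disj] unfolding other_def by blast
  have ext1: "extremal (W - X)"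
  proof (rule extremal_delete_transversal[OF ext])
    show "\<exists>c'. is_cycle (sub W) c' \<and> x \<in> set c'" if "x \<in> X" for x
      using that some unfolding X_def other_def by blast
    show "x = x'" if "is_cycle (sub W) c'" "x \<in> X" "x' \<in> X" "x \<in> set c'" "x' \<in> set c'" for c' x x'
    proof -
      obtain B B' where B: "B \<in> other" "x = (SOME x. x \<in> B)" "B' \<in> other" "x' = (SOME x. x \<in> B')"
        using \<open>x \<in> X\<close> \<open>x' \<in> X\<close> by (auto simp: X_def)
      then have "x \<in> B" "x' \<in> B'" using some by auto
      then have "B = set c'" "B' = set c'" using inB B that by blast+
      then show ?thesis using B by simp
    qed
  qed
  have cX: "set c \<inter> X = {}"
  proof (rule ccontr)
    assume "set c \<inter> X \<noteq> {}"
    then obtain B where B: "B \<in> other" "(SOME x. x \<in> B) \<in> set c" by (auto simp: X_def)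
    then have "B = set c" using inB[OF B(1) c some[OF B(1)]] by blast
    then show False using B(1) by (auto simp: other_def)
  qed
  have c1: "is_cycle (sub (W - X)) c" using c cX by (auto simp: is_cycle_sub)
  have only: "set c' = set c" if c': "is_cycle (sub (W - X)) c'" for c'
  proof (rule ccontr)
    assume "set c' \<noteq> set c"
    then have "set c' \<in> other" using c' by (auto simp: other_def is_cycle_sub)
    then have "(SOME x. x \<in> set c') \<in> set c' \<inter> X" using some by (auto simp: X_def)
    then show False using c' by (auto simp: is_cycle_sub)
  qed
  have "c \<noteq> []" using is_cycle_nonempty[OF c] .
  then have "1 \<le> d (W - X)"
    using d_delete_cycle_vertex[OF c1, of "hd c"] d_nonneg[of "W - X - {hd c}"] by simp
  moreover obtain V where V: "V \<subseteq> W - X" "crucial_subgraph (sub (W - X)) (sub V)" "extremal V" "d V = d (W - X)"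
    using extremal_crucial[OF ext1] by blast
  ultimately have dV: "1 \<le> d V" by simp
  have nopend: "\<not> pendant (sub V) u" for u using V(2) by (simp add: crucial_subgraph_def)
  have onlyV: "set c' = set c" if "is_cycle (sub V) c'" for c'
    using only that V(1) by (auto simp: is_cycle_sub)
  \<comment> \<open>The \<open>\<delta>\<close>-transformations kept \<open>d\<close> positive, so
    \<open>V\<close> still carries a cycle, whose vertex set can only be that of
    \<open>c\<close>.\<close>
  have "excess V \<noteq> 0" using V(3) dV unfolding extremal_def by linarith
  then obtain c' where c': "is_cycle (sub V) c'" using excess_acyclic by blast
  then have cV: "is_cycle (sub V) c" using onlyV[OF c'] c by (auto simp: is_cycle_sub)
  \<comment> \<open>Every cycle left in \<open>V\<close> has the vertex set of \<open>c\<close>, so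
    the request for kernel vectors of other cycles is vacuous here.\<close>
  have "{y, z} \<notin> snd G" if "y \<in> set c" "z \<in> V - set c" for y z
    using extremal_cycle_no_exit[OF V(3) nopend cV] onlyV that by blast
  then have "nullity_on M V = nullity_on M (set c) + nullity_on M (V - set c)"
    "nullity_on N V = nullity_on N (set c) + nullity_on N (V - set c)"
    using cV by (auto intro!: nullity_on_delete_component M N simp: is_cycle_sub)
  moreover have "excess (V - set c) = 0"
  proof (rule excess_acyclic)
    fix c'
    show "\<not> is_cycle (sub (V - set c)) c'"
    proof
      assume c': "is_cycle (sub (V - set c)) c'"
      then have "set c' = set c" by (intro onlyV) (auto simp: is_cycle_sub)
      moreover have "set c' \<subseteq> V - set c" using c' by (simp add: is_cycle_sub)
      ultimately show False using hd_in_set[OF \<open>c \<noteq> []\<close>] by blast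
    qed
  qed
  \<comment> \<open>The whole excess of \<open>V\<close>, at least 2, sits on the component
    \<open>set c\<close>. Since a cycle has nullity at most 2, both nullities are
    determined.\<close>
  ultimately have "2 \<le> excess (set c)"
    using V(3) dV unfolding extremal_def excess_def by linarith
  moreover interpret weighted_cycle "snd G" M c by (rule weighted_cycle_sub[OF disj c M])
  have "nullity_on M (set c) \<le> 2" by (rule nullity_cycle_le)
  ultimately show "nullity_on M (set c) = 2" "nullity_on N (set c) = 0"
    unfolding excess_def by linarith+
qed

lemma extremal_cycle_holonomy:
  assumes ext: "extremal W" and c: "is_cycle (sub W) c"
  shows "even (length c)" "holonomy M c = (-1) ^ (length c div 2)" "holonomy N c \<noteq> (-1) ^ (length c div 2)"
proof -
  have disj: "vertex_disjoint (cycles (sub W))" by (rule extremal_vertex_disjoint[OF ext])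
  note null = extremal_cycle_nullity[OF ext c]
  interpret MC: weighted_cycle "snd G" M c by (rule weighted_cycle_sub[OF disj c M])
  interpret NC: weighted_cycle "snd G" N c by (rule weighted_cycle_sub[OF disj c N])
  show ev: "even (length c)" using MC.nullity_cycle_2_even null(1) by simp
  show "holonomy M c = (-1) ^ (length c div 2)" using MC.nullity_cycle_holonomy[OF ev] null(1) by simp
  show "holonomy N c \<noteq> (-1) ^ (length c div 2)" using NC.nullity_cycle_eq_2[OF ev] null(2) by auto
qed

text \<open>The holonomies are now known for all cycles, so each of them supplies a kernel vector
  without zeros and the exclusion of exits works with several cycles present.\<close>

lemma extremal_no_exit:
  assumes ext: "extremal W" and nopend: "\<And>u. \<not> pendant (sub W) u" and c: "is_cycle (sub W) c"
    and yz: "y \<in> set c" "z \<in> W" "{y, z} \<in> snd G"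
  shows "z \<in> set c"
proof (rule ccontr)
  assume "z \<notin> set c"
  have disj: "vertex_disjoint (cycles (sub W))" by (rule extremal_vertex_disjoint[OF ext])
  have "\<exists>p\<in>kernel_on M (set c'). \<forall>v\<in>set c'. p $ v \<noteq> 0" if c': "is_cycle (sub W) c'" for c'
  proof -
    interpret weighted_cycle "snd G" M c' by (rule weighted_cycle_sub[OF disj c' M])
    show ?thesis using kernel_cycle_nowhere_zero extremal_cycle_holonomy(1,2)[OF ext c'] by metis
  qed
  then show False
    using extremal_cycle_no_exit[OF ext nopend c _ yz(1,2) \<open>z \<notin> set c\<close>] yz(3) by blast
qed

text \<open>The count is the number of cycles rather than \<open>d W\<close>; that the two agree
  follows later, as each is half of the excess.\<close>

lemma extremal_union_of_cycles:
  assumes ext: "extremal W" and nopend: "\<And>u. \<not> pendant (sub W) u"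
  shows "union_of_cycles_and_isolated (int (card (cycles (sub W)))) (sub W)"
proof -
  have disj: "vertex_disjoint (cycles (sub W))" by (rule extremal_vertex_disjoint[OF ext])
  let ?C = "cycles (sub W)"
  let ?U = "\<Union>C\<in>?C. fst C"
  have U_iff: "v \<in> ?U \<longleftrightarrow> (\<exists>c. is_cycle (sub W) c \<and> v \<in> set c)" for v
    by (auto simp: cycles_def)
  have UW: "?U \<subseteq> W" unfolding subset_iff U_iff is_cycle_sub by blast
  have fin: "finite ?C" by (rule finite)
  have induced: "C = induced_subgraph (sub W) (fst C)" if "C \<in> ?C" for C
  proof -
    obtain c where c: "is_cycle (sub W) c" "C = (set c, cycle_edges c)"
      using \<open>C \<in> ?C\<close> by (auto simp: cycles_def)
    have "cycle_edges c = {e \<in> snd (sub W). e \<subseteq> set c}"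
    proof
      show "cycle_edges c \<subseteq> {e \<in> snd (sub W). e \<subseteq> set c}"
        using c(1) Union_cycle_edges[OF is_cycle_nonempty[OF c(1)]] by (auto simp: is_cycle_def)
      show "{e \<in> snd (sub W). e \<subseteq> set c} \<subseteq> cycle_edges c"
      proof clarify
        fix e assume e: "e \<in> snd (sub W)" "e \<subseteq> set c"
        obtain u v where uv: "e = {u, v}" using simple_graph_edgeE[OF simple_sub e(1)] by blast
        then show "e \<in> cycle_edges c"
          using cycle_chordless[OF disj c(1), of u v] e by (auto simp: edge_sub)
      qed
    qed
    then show ?thesis by (simp add: c(2)) (simp add: induced_subgraph_def)
  qed
  have edges: "snd (sub W) = (\<Union>C\<in>?C. snd C)"
  proof
    show "(\<Union>C\<in>?C. snd C) \<subseteq> snd (sub W)" by (auto simp: cycles_def is_cycle_def)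
    show "snd (sub W) \<subseteq> (\<Union>C\<in>?C. snd C)"
    proof
      fix e assume e: "e \<in> snd (sub W)"
      obtain u v where uv: "e = {u, v}" using simple_graph_edgeE[OF simple_sub e] by blast
      have on_cycle: "e \<in> (\<Union>C\<in>?C. snd C)"
        if c: "is_cycle (sub W) c" "a \<in> set c" and ab: "e = {a, b}" for a b c
      proof -
        have e': "{a, b} \<in> snd G" "b \<in> W" using e ab by (auto simp: edge_sub)
        then have "b \<in> set c" using extremal_no_exit[OF ext nopend c] by blast
        then have "e \<in> cycle_edges c" using cycle_chordless[OF disj c] e' ab by blast
        moreover have "(set c, cycle_edges c) \<in> ?C" using c(1) unfolding cycles_def by blast
        ultimately show ?thesis by (intro UN_I) auto
      qed
      show "e \<in> (\<Union>C\<in>?C. snd C)"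
      proof (rule ccontr)
        assume no: "e \<notin> (\<Union>C\<in>?C. snd C)"
        have notU: "u \<notin> ?U" "v \<notin> ?U"
          using on_cycle[of _ u v] on_cycle[of _ v u] no uv unfolding U_iff by (metis insert_commute)+
        \<comment> \<open>The vertices off all cycles that are not isolated among themselves. This
          part is acyclic and no edge joins it to a cycle, so its vertex of low degree would be
          pendant in the whole graph.\<close>
        define V where "V = {a \<in> W - ?U. \<exists>b\<in>W - ?U. {a, b} \<in> snd G}"
        have "u \<in> V" using notU e uv unfolding V_def by (auto simp: edge_sub)
        then have "V \<noteq> {}" by blast
        moreover have "\<not> is_cycle (V, snd (sub V)) c" for c
        proof
          assume "is_cycle (V, snd (sub V)) c"
          then have c: "is_cycle (sub V) c" by (simp add: sub_pair)
          then have "is_cycle (sub W) c" unfolding is_cycle_sub V_def by blast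
          moreover have "hd c \<in> set c" "set c \<subseteq> V"
            using is_cycle_nonempty[OF c] c by (simp_all add: is_cycle_sub)
          ultimately have "hd c \<in> ?U" "hd c \<in> V" unfolding U_iff by blast+
          then show False unfolding V_def by blast
        qed
        ultimately obtain a where a: "a \<in> V"
          "\<And>b b'. {a, b} \<in> snd (sub V) \<Longrightarrow> {a, b'} \<in> snd (sub V) \<Longrightarrow> b = b'"
          using acyclic_has_low_degree_vertex[of V "snd (sub V)"] simple_sub by (metis sub_pair)
        have nbr: "{a, b} \<in> snd (sub V)" if b: "{a, b} \<in> snd (sub W)" for b
        proof -
          have ab: "{a, b} \<in> snd G" "b \<in> W" "a \<in> W" "a \<notin> ?U"
            using b a(1) unfolding V_def by (auto simp: edge_sub)
          have "b \<notin> ?U"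
          proof
            assume "b \<in> ?U"
            then obtain c where c: "is_cycle (sub W) c" "b \<in> set c" unfolding U_iff by blast
            have "{b, a} \<in> snd G" using ab(1) by (simp add: insert_commute)
            then have "a \<in> set c" using extremal_no_exit[OF ext nopend c] ab(3) by blast
            then show False using ab(4) c(1) unfolding U_iff by blast
          qed
          moreover have "{b, a} \<in> snd G" using ab(1) by (simp add: insert_commute)
          ultimately have "b \<in> V" using ab unfolding V_def by blast
          then show ?thesis using ab(1) a(1) by (simp add: edge_sub)
        qed
        obtain b where "b \<in> W" "{a, b} \<in> snd G" "a \<in> W" using a(1) unfolding V_def by blast
        then have b: "{a, b} \<in> snd (sub W)" by (simp add: edge_sub)
        have "pendant (sub W) a"
        proof (rule pendantI[OF simple_sub b])
          show "w = b" if "{a, w} \<in> snd (sub W)" for w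
            using a(2)[OF nbr[OF that] nbr[OF b]] .
        qed
        then show False using nopend by blast
      qed
    qed
  qed
  have "sub W = (?U \<union> (W - ?U), \<Union>C\<in>?C. snd C)"
    using edges UW sub_pair[of W] by (metis Un_Diff_cancel sup.absorb2)
  then show ?thesis
    unfolding union_of_cycles_and_isolated_def using fin induced disj
    by (intro exI[of _ ?C] exI[of _ "W - ?U"]) blast
qed

text \<open>Nullities add over components, each cycle contributing 2 to the excess. Both directions
  use this: one to identify the number of cycles with \<open>d\<close>, the other to compute the
  excess.\<close>

lemma excess_union_of_cycles:
  assumes un: "union_of_cycles_and_isolated m (sub W)"
    and null: "\<And>c. is_cycle (sub W) c \<Longrightarrow> nullity_on M (set c) = 2 \<and> nullity_on N (set c) = 0"
  shows "excess W = 2 * m"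
proof -
  obtain \<C> I where fin: "finite \<C>" and card: "int (card \<C>) = m" and cyc: "\<C> \<subseteq> cycles (sub W)"
    and disj: "vertex_disjoint \<C>" and I: "I \<inter> (\<Union>C\<in>\<C>. fst C) = {}"
    and W: "sub W = ((\<Union>C\<in>\<C>. fst C) \<union> I, \<Union>C\<in>\<C>. snd C)"
    using un unfolding union_of_cycles_and_isolated_def by blast
  have W_eq: "W = (\<Union>C\<in>\<C>. fst C) \<union> I" and E_eq: "snd (sub W) = (\<Union>C\<in>\<C>. snd C)"
    using W by (metis fst_conv fst_induced_subgraph, metis snd_conv)
  have same: "\<exists>C\<in>\<C>. u \<in> fst C \<and> v \<in> fst C" if uv: "{u, v} \<in> snd G" "u \<in> W" "v \<in> W" for u v
  proof -
    have "{u, v} \<in> snd (sub W)" using uv by (simp add: edge_sub)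
    then obtain C where C: "C \<in> \<C>" "{u, v} \<in> snd C" unfolding E_eq by blast
    then obtain c where "is_cycle (sub W) c" "C = (set c, cycle_edges c)"
      using cyc by (auto simp: cycles_def)
    then show ?thesis using C cycle_edge_vertices[OF is_cycle_nonempty, of "sub W" c u v]
      by (intro bexI[of _ C]) auto
  qed
  have "excess (\<Union>C\<in>\<D>. fst C) = 2 * int (card \<D>)" if "finite \<D>" "\<D> \<subseteq> \<C>" for \<D>
    using that
  proof (induction \<D> rule: finite_induct)
    case empty
    then show ?case by (simp add: excess_def)
  next
    case (insert C \<D>)
    let ?S = "fst C" and ?T = "\<Union>C\<in>\<D>. fst C"
    have ST: "?S \<inter> ?T = {}"
    proof -
      have "?S \<inter> fst D = {}" if "D \<in> \<D>" for D
        using disj[unfolded vertex_disjoint_def, rule_format, of C D] insert.hyps(2) insert.prems that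
        by auto
      then show ?thesis by blast
    qed
    have TW: "?T \<subseteq> W" "?S \<subseteq> W" using insert.prems W_eq by blast+
    have no: "{y, z} \<notin> snd G" if y: "y \<in> ?S" and z: "z \<in> ?T" for y z
    proof
      assume "{y, z} \<in> snd G"
      then obtain D where D: "D \<in> \<C>" "y \<in> fst D" "z \<in> fst D" using same y z TW by blast
      then have "D = C"
        using disj[unfolded vertex_disjoint_def, rule_format, of D C] y insert.prems by blast
      then show False using D(3) z ST by blast
    qed
    have diff: "?S \<union> ?T - ?S = ?T" using ST by blast
    have nulM: "nullity_on M (?S \<union> ?T) = nullity_on M ?S + nullity_on M ?T"
      using nullity_on_delete_component[OF M, of ?S "?S \<union> ?T"] no unfolding diff by blast
    have nulN: "nullity_on N (?S \<union> ?T) = nullity_on N ?S + nullity_on N ?T"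
      using nullity_on_delete_component[OF N, of ?S "?S \<union> ?T"] no unfolding diff by blast
    obtain c where c: "is_cycle (sub W) c" "?S = set c"
      using insert.prems cyc by (auto simp: cycles_def)
    have IH: "excess ?T = 2 * int (card \<D>)" using insert.IH insert.prems by blast
    have "(\<Union>C\<in>insert C \<D>. fst C) = ?S \<union> ?T" by simp
    then show ?case
      using IH null[OF c(1)] nulM nulN insert.hyps unfolding excess_def c(2) by simp
  qed
  from this[OF fin subset_refl] have U: "excess (\<Union>C\<in>\<C>. fst C) = 2 * m" using card by simp
  \<comment> \<open>Every edge has both ends in one of the listed cycles, so \<open>I\<close>
    induces no edge.\<close>
  have Icyc: "excess I = 0"
  proof (rule excess_acyclic)
    fix c
    show "\<not> is_cycle (sub I) c"
    proof
      assume c: "is_cycle (sub I) c"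
      then have "{vtx c 0, vtx c (Suc 0)} \<in> snd (sub I)"
        using is_cycle_nonempty[OF c] by (auto simp: is_cycle_def cycle_edges_eq_range)
      then have "{vtx c 0, vtx c (Suc 0)} \<in> snd G" "vtx c 0 \<in> I" "vtx c (Suc 0) \<in> I" by (auto simp: edge_sub)
      then show False using same[of "vtx c 0" "vtx c (Suc 0)"] I W_eq by blast
    qed
  qed
  have no: "{y, z} \<notin> snd G" if "y \<in> I" "z \<in> W - I" for y z
    using same[of y z] that I W_eq by blast
  have diff: "W - I = (\<Union>C\<in>\<C>. fst C)" using W_eq I by blast
  have "I \<subseteq> W" using W_eq by blast
  then have "excess W = excess I + excess (W - I)"
    using nullity_on_delete_component[OF M _ no] nullity_on_delete_component[OF N _ no]
    by (simp add: excess_def)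
  then show ?thesis using U Icyc diff by simp
qed

lemma sub_UNIV: "sub UNIV = G"
  using univ by (cases G) (simp add: induced_subgraph_def)

text \<open>In the converse direction equality is what has to be shown, so only the excess is
  followed through the given transformations.\<close>

lemma delta_rtranclp_sub:
  assumes "delta_transformation\<^sup>*\<^sup>* (sub W) H"
  shows "\<exists>V\<subseteq>W. H = sub V \<and> excess V = excess W"
  using assms
proof (induction rule: rtranclp_induct)
  case base
  then show ?case by blast
next
  case (step H H')
  then obtain V where V: "V \<subseteq> W" "H = sub V" "excess V = excess W" by blast
  then obtain u v where "pendant (sub V) u" "{u, v} \<in> snd (sub V)" "H' = sub (V - {u, v})"
    using step.hyps(2) by (auto simp: delta_transformation_sub)
  then show ?case using V excess_delta by (intro exI[of _ "V - {u, v}"]) auto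
qed

text \<open>The two conditions on the holonomies say that on every cycle \<open>M\<close> has the
  largest possible nullity 2 and \<open>N\<close> is nonsingular.\<close>

theorem extremal_UNIV_iff:
  "extremal UNIV \<longleftrightarrow> vertex_disjoint (cycles G) \<and>
     (\<forall>c. is_cycle G c \<longrightarrow> even (length c) \<and> holonomy M c = (-1) ^ (length c div 2) \<and>
        holonomy N c \<noteq> (-1) ^ (length c div 2)) \<and>
     (\<exists>H. crucial_subgraph G H \<and> union_of_cycles_and_isolated (cyclomatic_number G) H)"
proof
  assume ext: "extremal UNIV"
  obtain V where V: "crucial_subgraph (sub UNIV) (sub V)" "extremal V" "d V = d UNIV"
    using extremal_crucial[OF ext] by blast
  have nopend: "\<not> pendant (sub V) u" for u using V(1) by (simp add: crucial_subgraph_def)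
  have un: "union_of_cycles_and_isolated (int (card (cycles (sub V)))) (sub V)"
    by (rule extremal_union_of_cycles[OF V(2) nopend])
  \<comment> \<open>The excess is evaluated twice: by counting the cycles of the crucial subgraph,
    and as \<open>2 * d V\<close> by equality.\<close>
  have "excess V = 2 * int (card (cycles (sub V)))"
    using excess_union_of_cycles[OF un] extremal_cycle_nullity[OF V(2)] by blast
  then have "int (card (cycles (sub V))) = cyclomatic_number G"
    using V(2,3) unfolding extremal_def d_def sub_UNIV by simp
  then have "\<exists>H. crucial_subgraph G H \<and> union_of_cycles_and_isolated (cyclomatic_number G) H"
    using V(1) un unfolding sub_UNIV by metis
  then show "vertex_disjoint (cycles G) \<and>
     (\<forall>c. is_cycle G c \<longrightarrow> even (length c) \<and> holonomy M c = (-1) ^ (length c div 2) \<and>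
        holonomy N c \<noteq> (-1) ^ (length c div 2)) \<and>
     (\<exists>H. crucial_subgraph G H \<and> union_of_cycles_and_isolated (cyclomatic_number G) H)"
    using extremal_vertex_disjoint[OF ext] extremal_cycle_holonomy[OF ext] unfolding sub_UNIV
    by simp
next
  assume R: "vertex_disjoint (cycles G) \<and>
     (\<forall>c. is_cycle G c \<longrightarrow> even (length c) \<and> holonomy M c = (-1) ^ (length c div 2) \<and>
        holonomy N c \<noteq> (-1) ^ (length c div 2)) \<and>
     (\<exists>H. crucial_subgraph G H \<and> union_of_cycles_and_isolated (cyclomatic_number G) H)"
  then obtain H where H: "delta_transformation\<^sup>*\<^sup>* (sub UNIV) H"
    "union_of_cycles_and_isolated (cyclomatic_number G) H"
    unfolding crucial_subgraph_def sub_UNIV by blast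
  obtain V where V: "H = sub V" "excess V = excess UNIV" using delta_rtranclp_sub[OF H(1)] by blast
  have disj: "vertex_disjoint (cycles (sub UNIV))" using R unfolding sub_UNIV by blast
  have "excess V = 2 * cyclomatic_number G"
  proof (rule excess_union_of_cycles)
    show "union_of_cycles_and_isolated (cyclomatic_number G) (sub V)" using H(2) V(1) by simp
    fix c assume "is_cycle (sub V) c"
    then have c: "is_cycle G c" by (simp add: is_cycle_sub)
    then have c': "is_cycle (sub UNIV) c" unfolding sub_UNIV .
    have hol: "even (length c)" "holonomy M c = (-1) ^ (length c div 2)"
      "holonomy N c \<noteq> (-1) ^ (length c div 2)" using R c by simp_all
    interpret MC: weighted_cycle "snd G" M c by (rule weighted_cycle_sub[OF disj c' M])
    interpret NC: weighted_cycle "snd G" N c by (rule weighted_cycle_sub[OF disj c' N])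
    show "nullity_on M (set c) = 2 \<and> nullity_on N (set c) = 0"
      using MC.nullity_cycle_eq_2[OF hol(1,2)] NC.nullity_cycle_holonomy[OF hol(1)] hol(3) by blast
  qed
  then show "extremal UNIV" unfolding extremal_def d_def sub_UNIV using V(2) by simp
qed

end

section \<open>Adjacency matrices\<close>

lemma weights_adjacency_matrix: "weights (snd G) (adjacency_matrix G)"
  by (simp add: weights_def adjacency_matrix_def insert_commute)

lemma mixed_graph_arcD:
  assumes "mixed_graph G A" "(u, v) \<in> A"
  shows "{u, v} \<in> snd G" "(v, u) \<notin> A"
  using assms by (auto simp: mixed_graph_def)

lemma weights_hermitian_adjacency_matrix:
  assumes "mixed_graph G A"
  shows "weights (snd G) (hermitian_adjacency_matrix G A)" (is "weights _ ?H")
proof -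
  have "({u, v} \<in> snd G \<longrightarrow> ?H $ u $ v * ?H $ v $ u = 1) \<and> ({u, v} \<notin> snd G \<longrightarrow> ?H $ u $ v = 0)" for u v
  proof -
    have comm: "{v, u} = {u, v}" by (rule insert_commute)
    consider "(u, v) \<in> A" | "(v, u) \<in> A" | "(u, v) \<notin> A" "(v, u) \<notin> A" by blast
    then show ?thesis
    proof cases
      case 1
      then show ?thesis using mixed_graph_arcD[OF assms 1] by (simp add: hermitian_adjacency_matrix_def)
    next
      case 2
      then show ?thesis
        using mixed_graph_arcD[OF assms 2] by (simp add: hermitian_adjacency_matrix_def comm)
    qed (simp add: hermitian_adjacency_matrix_def comm)
  qed
  then show ?thesis unfolding weights_def by blast
qed

lemma holonomy_adjacency_matrix:
  assumes "is_cycle G c"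
  shows "holonomy (adjacency_matrix G) c = 1"
proof -
  have "{c ! i, next_vertex c i} \<in> snd G" if "i < length c" for i
    using assms that by (auto simp: is_cycle_def cycle_edges_def)
  then show ?thesis by (simp add: holonomy_def adjacency_matrix_def)
qed

lemma prod_if_power:
  fixes n :: nat
  shows "(\<Prod>i<n. if P i then x else 1) = (x::'a::comm_monoid_mult) ^ card {i. i < n \<and> P i}"
proof -
  have "(\<Prod>i<n. if P i then x else 1) = (\<Prod>i\<in>{i. i < n \<and> P i}. x)"
    by (intro prod.mono_neutral_cong_right) auto
  then show ?thesis by simp
qed

lemma holonomy_hermitian_adjacency_matrix:
  assumes mix: "mixed_graph G A" and c: "is_cycle G c"
  shows "holonomy (hermitian_adjacency_matrix G A) c
    = \<i> ^ forward_arcs A c * (- \<i>) ^ backward_arcs A c"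
proof -
  have "hermitian_adjacency_matrix G A $ (c ! i) $ next_vertex c i
      = (if (c ! i, next_vertex c i) \<in> A then \<i> else 1) * (if (next_vertex c i, c ! i) \<in> A then - \<i> else 1)"
    if i: "i < length c" for i
  proof -
    have "{c ! i, next_vertex c i} \<in> snd G"
      using c i by (auto simp: is_cycle_def cycle_edges_def)
    then show ?thesis
      using mixed_graph_arcD(2)[OF mix] by (auto simp: hermitian_adjacency_matrix_def)
  qed
  then have "holonomy (hermitian_adjacency_matrix G A) c
      = (\<Prod>i<length c. (if (c ! i, next_vertex c i) \<in> A then \<i> else 1)
          * (if (next_vertex c i, c ! i) \<in> A then - \<i> else 1))"
    unfolding holonomy_def by (intro prod.cong) auto
  then show ?thesis by (simp add: prod.distrib prod_if_power forward_arcs_def backward_arcs_def)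
qed

lemma ii_power_eq_minus_1_iff: "\<i> ^ n = - 1 \<longleftrightarrow> n mod 4 = 2"
proof -
  have "\<i> ^ n = \<i> ^ (4 * (n div 4) + n mod 4)" by simp
  also have "\<dots> = (\<i> ^ 4) ^ (n div 4) * \<i> ^ (n mod 4)" by (simp only: power_add power_mult)
  also have "\<i> ^ 4 = 1" by (simp add: power4_eq_xxxx)
  finally have "\<i> ^ n = \<i> ^ (n mod 4)" by simp
  moreover have "n mod 4 \<in> {0, 1, 2, 3}" by auto
  ultimately show ?thesis by (auto simp: power3_eq_cube complex_eq_iff)
qed

text \<open>Writing \<open>- \<i>\<close> as \<open>\<i> ^ 3\<close> keeps the exponent natural and
  turns \<open>- b\<close> into \<open>3 * b\<close>. The absolute value does no harm because 2 and
  -2 agree modulo 4.\<close>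

lemma abs_diff_mod_4: "(f + 3 * b) mod 4 = 2 \<longleftrightarrow> \<bar>int f - int b\<bar> mod 4 = 2"
proof -
  have "(f + 3 * b) mod 4 = 2 \<longleftrightarrow> (int f - int b) mod 4 = 2" by presburger
  moreover have "x mod 4 = 2 \<longleftrightarrow> (- x) mod 4 = 2" for x :: int by presburger
  from this[of "int f - int b"] have "(int f - int b) mod 4 = 2 \<longleftrightarrow> \<bar>int f - int b\<bar> mod 4 = 2"
    by (cases "b \<le> f") (simp_all add: abs_if)
  ultimately show ?thesis by blast
qed

lemma holonomy_hermitian_eq_minus_1_iff:
  assumes "mixed_graph G A" "is_cycle G c"
  shows "holonomy (hermitian_adjacency_matrix G A) c = - 1 \<longleftrightarrow> signature A c mod 4 = 2"
proof -
  let ?f = "forward_arcs A c" and ?b = "backward_arcs A c"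
  have "(- \<i>) = \<i> ^ 3" by (simp add: power3_eq_cube)
  then have "holonomy (hermitian_adjacency_matrix G A) c = \<i> ^ (?f + 3 * ?b)"
    using holonomy_hermitian_adjacency_matrix[OF assms] by (simp only: power_add power_mult)
  then have "holonomy (hermitian_adjacency_matrix G A) c = - 1 \<longleftrightarrow> (?f + 3 * ?b) mod 4 = 2"
    by (simp only: ii_power_eq_minus_1_iff)
  also have "\<dots> \<longleftrightarrow> signature A c mod 4 = 2"
    unfolding signature_def by (rule abs_diff_mod_4)
  finally show ?thesis .
qed

theorem theorem1p3:
  fixes G :: "'v::finite graph" and A :: "('v \<times> 'v) set"
  assumes "fst G = UNIV" and "mixed_graph G A"
  shows "int (rank (hermitian_adjacency_matrix G A)) - int (rank (adjacency_matrix G))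
           = - 2 * cyclomatic_number G \<longleftrightarrow>
         vertex_disjoint (cycles G) \<and>
         (\<forall>c. is_cycle G c \<longrightarrow> length c mod 4 = 2 \<and> signature A c mod 4 = 2) \<and>
         (\<exists>H. crucial_subgraph G H \<and> union_of_cycles_and_isolated (cyclomatic_number G) H)"
proof -
  let ?M = "hermitian_adjacency_matrix G A" and ?N = "adjacency_matrix G"
  interpret weighted_pair G ?M ?N
    using assms weights_adjacency_matrix[of G] weights_hermitian_adjacency_matrix[OF assms(2)]
    by unfold_locales (simp_all add: mixed_graph_def)
  have "int (rank ?M) - int (rank ?N) = - excess UNIV"
    using rank_eq_card_minus_nullity_on[of ?M] rank_eq_card_minus_nullity_on[of ?N]
    unfolding excess_def by linarith
  then have "int (rank ?M) - int (rank ?N) = - 2 * cyclomatic_number G \<longleftrightarrow> extremal UNIV"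
    unfolding extremal_def d_def sub_UNIV by linarith
  moreover have "even (length c) \<and> holonomy ?M c = (-1) ^ (length c div 2) \<and>
        holonomy ?N c \<noteq> (-1) ^ (length c div 2) \<longleftrightarrow> length c mod 4 = 2 \<and> signature A c mod 4 = 2"
    if c: "is_cycle G c" for c
  proof -
    \<comment> \<open>The adjacency holonomy is 1, so its condition says that half the length is
      odd; the value required of the Hermitian holonomy then becomes -1.\<close>
    have sq: "even (length c) \<and> (1::real) \<noteq> (-1) ^ (length c div 2) \<longleftrightarrow> length c mod 4 = 2"
    proof -
      have "(1::real) \<noteq> (-1) ^ (length c div 2) \<longleftrightarrow> odd (length c div 2)"
        by (cases "even (length c div 2)") auto
      moreover have "even (length c) \<and> odd (length c div 2) \<longleftrightarrow> length c mod 4 = 2" by presburger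
      ultimately show ?thesis by simp
    qed
    have "(-1) ^ (length c div 2) = (-1::complex)" if "length c mod 4 = 2"
    proof -
      have "odd (length c div 2)" using that by presburger
      then show ?thesis by simp
    qed
    then show ?thesis
      using sq holonomy_hermitian_eq_minus_1_iff[OF assms(2) c] holonomy_adjacency_matrix[OF c] by auto
  qed
  ultimately show ?thesis unfolding extremal_UNIV_iff by (simp cong: conj_cong)
qed

end
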